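(* Let $r\in\{0,1,2,\dots\}$ be fixed and let $n\to\infty$. Then the number $X^{\blacksquare}_{n,r}$ of old leaves and the number $X^{\bullet}_{n,r}$ of nodes that are neither old leaves nor parents of old leaves in the $r$-fold old-path-reduced random plane tree satisfy $$\mathbb{E}X^{\blacksquare}_{n,r}=\frac{1}{(r+2)^2}n+\frac{(r+3)(r+1)}{6(r+2)^2}+O(n^{-1}),$$ $$\mathbb{E}X^{\bullet}_{n,r}=\frac{2(r+1)}{(r+2)^2}n-\frac{(r^2+3r+3)(r+1)}{3(r+2)^2}+O(n^{-1}),$$ $$\mathbb{V}X^{\blacksquare}_{n,r}=\frac{(r+3)(r+1)}{3(r+2)^4}n+O(1),\qquad \mathbb{V}X^{\bullet}_{n,r}=\frac{2(r^3+4r^2+6r+6)(r+1)}{3(r+2)^4}n+O(1).$$ Additionally, for fixed $d\ge2$, $$\mathbb{E}(X^{\blacksquare}_{n,r})^{\underline d}=\frac{1}{(r+2)^{2d}}n^d+O(n^{d-1}),\qquad \mathbb{E}(X^{\bullet}_{n,r})^{\underline d}=\frac{2^d(r+1)^d}{(r+2)^{2d}}n^d+O(n^{d-1}).$$ All $O$-constants may depend on $r$ (and on $d$).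
   Context: A plane tree is a finite rooted tree in which the children of every node are linearly ordered (from left to right); its size is its number of nodes. An old leaf is a leaf (node without children) that is the leftmost child of its parent; the root is never an old leaf. A path is a plane tree in which every node has at most one child (including the single-node tree). For a plane tree $\tau$, $\rho(\tau)$ is the plane tree obtained by cutting all old paths, i.e. by simultaneously deleting every non-root node $v$ such that $v$ is the leftmost child of its parent and the subtree of $\tau$ consisting of $v$ and all its descendants is a path; the single-node tree is mapped to itself. Let $\tau$ be chosen uniformly at random among all plane trees of size $n$. $X^{\blacksquare}_{n,r}$ is the number of old leaves of $\rho^r(\tau)$ and $X^{\bullet}_{n,r}$ is the number of nodes of $\rho^r(\tau)$ that are neither old leaves nor parents of old leaves. Falling factorial: $x^{\underline d}=x(x-1)\cdots(x-d+1)$. *)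

theory Defs
  imports "HOL-Probability.Probability" "HOL-Library.Landau_Symbols"
begin

datatype plane_tree = Node (children: "plane_tree list")

text \<open>
  Nodes are addressed by the list of child indices (starting from 0, the leftmost child) on the
  way down from the root, whose address is the empty list. Hence a non-root node \<open>v\<close> is the leftmost
  child of its parent iff \<open>last v = 0\<close>, and its parent is \<open>butlast v\<close>.
\<close>

fun subtree :: "plane_tree \<Rightarrow> nat list \<Rightarrow> plane_tree option" where
  "subtree t [] = Some t"
| "subtree (Node ts) (i # v) = (if i < length ts then subtree (ts ! i) v else None)"

definition nodes :: "plane_tree \<Rightarrow> nat list set" where
  "nodes t = {v. subtree t v \<noteq> None}"

definition tree_size :: "plane_tree \<Rightarrow> nat" where
  "tree_size t = card (nodes t)"

definition old_leaves :: "plane_tree \<Rightarrow> nat list set" where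
  "old_leaves t = {v \<in> nodes t. v \<noteq> [] \<and> last v = 0 \<and> subtree t v = Some (Node [])}"

definition is_path :: "plane_tree \<Rightarrow> bool" where
  "is_path t \<longleftrightarrow> (\<forall>v s. subtree t v = Some s \<longrightarrow> length (children s) \<le> 1)"

text \<open>
  Cutting is simultaneous: whether the leftmost child is deleted is decided on the original tree,
  and the former second child is not examined as a leftmost child in the same step.
\<close>

fun rho :: "plane_tree \<Rightarrow> plane_tree" where
  "rho (Node []) = Node []"
| "rho (Node (t # ts)) = Node (if is_path t then map rho ts else rho t # map rho ts)"

definition X_square :: "nat \<Rightarrow> plane_tree \<Rightarrow> nat" where
  "X_square r t = card (old_leaves ((rho ^^ r) t))"

definition X_bullet :: "nat \<Rightarrow> plane_tree \<Rightarrow> nat" where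
  "X_bullet r t =
     (let s = (rho ^^ r) t in card (nodes s - (old_leaves s \<union> butlast ` old_leaves s)))"

definition random_plane_tree :: "nat \<Rightarrow> plane_tree pmf" where
  "random_plane_tree n = pmf_of_set {t. tree_size t = n}"

definition falling_fact :: "real \<Rightarrow> nat \<Rightarrow> real" where
  "falling_fact x d = (\<Prod>i<d. x - real i)"

text \<open>
  The set of plane trees of size \<open>n\<close> is finite, and nonempty for \<open>n \<ge> 1\<close>, so
  \<^const>\<open>random_plane_tree\<close> is indeed uniform for all \<open>n \<ge> 1\<close>.
\<close>

lemma nodes_Node: "nodes (Node ts) = insert [] (\<Union>i<length ts. (#) i ` nodes (ts ! i))"
proof (rule set_eqI)
  fix v show "v \<in> nodes (Node ts) \<longleftrightarrow> v \<in> insert [] (\<Union>i<length ts. (#) i ` nodes (ts ! i))"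
    by (cases v) (auto simp: nodes_def split: if_splits)
qed

lemma finite_nodes: "finite (nodes t)"
  by (induction t) (auto simp: nodes_Node)

lemma tree_size_Node: "tree_size (Node ts) = Suc (sum_list (map tree_size ts))"
proof -
  have "card (\<Union>i<length ts. (#) i ` nodes (ts ! i)) = (\<Sum>i<length ts. card ((#) i ` nodes (ts ! i)))"
    by (rule card_UN_disjoint) (auto simp: finite_nodes)
  also have "\<dots> = (\<Sum>i<length ts. tree_size (ts ! i))"
    by (simp add: card_image tree_size_def)
  also have "\<dots> = sum_list (map tree_size ts)"
    by (simp add: sum_list_sum_nth atLeast0LessThan)
  finally show ?thesis
    unfolding tree_size_def[of "Node ts"] nodes_Node
    by (subst card_insert_disjoint) (auto simp: finite_nodes)
qed

lemma finite_plane_trees_le: "finite {t. tree_size t \<le> n}"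
proof (induction n)
  case 0
  have "{t. tree_size t \<le> 0} = {}"
  proof -
    have "\<not> tree_size t \<le> 0" for t by (cases t) (simp add: tree_size_Node)
    then show ?thesis by blast
  qed
  then show ?case by (metis finite.emptyI)
next
  case (Suc n)
  let ?L = "{ts. set ts \<subseteq> {t. tree_size t \<le> n} \<and> length ts \<le> n}"
  have len: "length ts \<le> sum_list (map tree_size ts)" for ts
  proof (induction ts)
    case (Cons t ts) then show ?case by (cases t) (simp add: tree_size_Node)
  qed simp
  have "{t. tree_size t \<le> Suc n} \<subseteq> Node ` ?L"
  proof
    fix t assume "t \<in> {t. tree_size t \<le> Suc n}"
    then obtain ts where t: "t = Node ts" and le: "sum_list (map tree_size ts) \<le> n"
      by (cases t) (auto simp: tree_size_Node)
    have "tree_size s \<le> n" if "s \<in> set ts" for s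
      using that le member_le_sum_list[of "tree_size s" "map tree_size ts"] by force
    with len[of ts] le have "ts \<in> ?L" by auto
    then show "t \<in> Node ` ?L" using t by blast
  qed
  moreover have "finite (Node ` ?L)"
    by (intro finite_imageI finite_lists_length_le Suc.IH)
  ultimately show ?case by (rule finite_subset)
qed

lemma finite_plane_trees: "finite {t. tree_size t = n}"
  by (rule finite_subset[OF _ finite_plane_trees_le[of n]]) auto

lemma plane_trees_nonempty:
  assumes "n \<ge> 1" shows "{t. tree_size t = n} \<noteq> {}"
proof -
  have "tree_size (Node (replicate (n - 1) (Node []))) = n"
    using assms by (simp add: tree_size_Node sum_list_replicate)
  then show ?thesis by blast
qed

end

theory Submission
  imports Defs "HOL-Real_Asymp.Real_Asymp"
begin

text \<open>
  Appending a last subtree to the root turns plane trees into binary trees: every tree is a leaf or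
  a grafting \<open>graft s u\<close> of \<open>u\<close> as last child onto \<open>s\<close>. The \<open>r\<close>-fold reduction of \<open>graft s u\<close> is the grafting
  of the \<open>r\<close>-fold reductions, unless \<open>u\<close> is cut off as a whole, in which case it is a leaf
  (\<open>funpow_rho_graft\<close>). Hence the generating function \<open>F\<close> of plane trees by size, with \<open>x\<close> marking
  old leaves and \<open>y\<close> the nodes that are neither old leaves nor their parents, both counted after \<open>r\<close> reductions, satisfies
  \<open>F - F\<^sup>2 = y z - y\<^sup>2 z\<^sup>2 + x (X - z + z\<^sup>2)\<close>, where \<open>z\<close> is the generating function of the trees that are
  reduced to a single node by \<open>r\<close> reductions (\<open>weighted_tree_gf\<close>).

  Let \<open>C\<close> be the generating function of all plane trees, \<open>C - C\<^sup>2 = X\<close>. Then \<open>F\<close> is \<open>C\<close> evaluated at the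
  right-hand side above. For \<open>x = 1 + \<epsilon>\<close>, \<open>y = 1\<close> this argument is \<open>X + \<epsilon> A\<close> with
  \<open>A = X - z + z\<^sup>2\<close>, and for \<open>x = 1\<close>, \<open>y = 1 + \<epsilon>\<close> it is \<open>X + \<epsilon> A - \<epsilon>\<^sup>2 B\<close> with \<open>A = z - 2 z\<^sup>2\<close> and
  \<open>B = z\<^sup>2\<close>. Taylor expansion in \<open>\<epsilon>\<close> therefore expresses the generating functions of the
  binomial moments by the derivatives of \<open>C\<close> and by \<open>A\<close> and \<open>B\<close> (\<open>moment_gf_nth\<close>): the first moments
  belong to \<open>C' A\<close>, the second ones to \<open>C'' A\<^sup>2 / 2 - C' B\<close>, and those of order \<open>d\<close> to the \<open>d\<close>-th derivative
  of \<open>C\<close> times \<open>A\<^sup>d / d!\<close>, up to lower derivatives.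

  The derivatives of \<open>C\<close> are multiples of odd powers of the square root of \<open>1 - 4 X\<close>, with explicit
  coefficients. The series \<open>z\<close>, given by the recursion \<open>z\<^sub>0 = X\<close>, \<open>z\<^sub>r\<^sub>+\<^sub>1 = X / (1 - z\<^sub>r)\<close>, converges
  beyond \<open>1/4\<close>, and by induction on \<open>r\<close> its expansion in powers of \<open>1 - 4 X\<close> begins with
  \<open>(r + 1) / (2 (r + 2)) - (r + 1) (r + 3) / (6 (r + 2)) * (1 - 4 X)\<close> (\<open>collapsed_gf_expands\<close>). Each
  factor \<open>1 - 4 X\<close> lowers the order of the coefficients by one power of \<open>n\<close>, and multiplying by a series
  that converges beyond \<open>1/4\<close> preserves it (\<open>subcritical_mult_bigo\<close>). So two terms of the expansion of
  \<open>z\<close> determine the expectations up to \<open>O(1/n)\<close> and the variances up to \<open>O(1)\<close>.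
\<close>

unbundle no vec_syntax
unbundle fps_syntax

section \<open>Reduction and grafting\<close>

text \<open>
  Splitting off the last subtree turns plane trees into binary trees with sizes adding up. The last
  subtree, rather than the first one, is split off because cutting works from the left: it is decided
  by the first child, so it commutes with appending a last child as long as that child is not the
  only one.
\<close>

definition graft :: "plane_tree \<Rightarrow> plane_tree \<Rightarrow> plane_tree" where
  "graft s u = Node (children s @ [u])"

abbreviation leaf :: plane_tree where "leaf \<equiv> Node []"

lemma graft_neq_leaf [simp]: "graft s u \<noteq> leaf" "leaf \<noteq> graft s u"
  by (simp_all add: graft_def)

lemma graft_eq_iff [simp]: "graft s u = graft s' u' \<longleftrightarrow> s = s' \<and> u = u'"
  by (cases s; cases s') (auto simp: graft_def)

lemma leaf_or_graft: "t = leaf \<or> (\<exists>s u. t = graft s u)"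
proof (cases t)
  case (Node ts)
  show ?thesis
  proof (cases ts rule: rev_cases)
    case (snoc ss u)
    then have "t = graft (Node ss) u" by (simp add: Node graft_def)
    then show ?thesis by blast
  qed (simp add: Node)
qed

lemma tree_size_leaf [simp]: "tree_size leaf = 1"
  by (simp add: tree_size_Node)

lemma tree_size_graft [simp]: "tree_size (graft s u) = tree_size s + tree_size u"
  by (cases s) (simp add: graft_def tree_size_Node)

lemma tree_size_pos [simp]: "tree_size t > 0"
  by (cases t) (simp add: tree_size_Node)

lemma tree_size_neq_0 [simp]: "tree_size t \<noteq> 0"
  using tree_size_pos[of t] by linarith

lemma is_path_leaf [simp]: "is_path leaf"
  unfolding is_path_def
proof (intro allI impI)
  fix v s assume "subtree leaf v = Some s"
  then show "length (children s) \<le> 1" by (cases v) auto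
qed

lemma is_path_singleton: "is_path (Node [t]) \<longleftrightarrow> is_path t"
proof
  assume *: "is_path (Node [t])"
  show "is_path t"
    unfolding is_path_def
  proof (intro allI impI)
    fix v s assume "subtree t v = Some s"
    then have "subtree (Node [t]) (0 # v) = Some s" by simp
    with * show "length (children s) \<le> 1" unfolding is_path_def by blast
  qed
next
  assume *: "is_path t"
  show "is_path (Node [t])"
    unfolding is_path_def
  proof (intro allI impI)
    fix v s assume v: "subtree (Node [t]) v = Some s"
    show "length (children s) \<le> 1"
    proof (cases v)
      case (Cons i v')
      with v * show ?thesis unfolding is_path_def by (auto split: if_splits)
    qed (use v in auto)
  qed
qed

lemma not_is_path_branching: "\<not> is_path (Node (s # t # ts))"
proof
  assume "is_path (Node (s # t # ts))"
  moreover have "subtree (Node (s # t # ts)) [] = Some (Node (s # t # ts))" by simp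
  ultimately have "length (children (Node (s # t # ts))) \<le> 1" unfolding is_path_def by blast
  then show False by simp
qed

lemma rho_eq_leaf_iff: "rho t = leaf \<longleftrightarrow> is_path t"
proof (cases t)
  case (Node ts)
  consider "ts = []" | u where "ts = [u]" | u v us where "ts = u # v # us"
    by (metis neq_Nil_conv)
  then show ?thesis
    by cases (auto simp: Node is_path_singleton not_is_path_branching)
qed

text \<open>
  Only a subtree grafted onto a leaf is itself a leftmost child, so only then can it be cut as a
  whole; the condition that it is a path reads \<open>rho u = leaf\<close>. Expressing it this way makes the
  rule iterate.
\<close>

lemma rho_graft: "rho (graft s u) = (if s = leaf \<and> rho u = leaf then leaf else graft (rho s) (rho u))"
proof (cases s)
  case (Node ts)
  then show ?thesis by (cases ts) (auto simp: graft_def rho_eq_leaf_iff)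
qed

lemma funpow_rho_leaf [simp]: "(rho ^^ r) leaf = leaf"
  by (induction r) auto

text \<open>
  In the first \<open>r\<close> steps the last subtree \<open>u\<close> is cut off precisely if \<open>s\<close> has become a leaf at some
  time \<open>i < r\<close> at which \<open>u\<close> has become a path, so that \<open>u\<close> is a leaf at time \<open>Suc i\<close>. Once a leaf, always a
  leaf; so it suffices to look at the last possible time.
\<close>

lemma funpow_rho_graft:
  "(rho ^^ r) (graft s u) =
     (if (\<exists>q. r = Suc q \<and> (rho ^^ q) s = leaf) \<and> (rho ^^ r) u = leaf then leaf
      else graft ((rho ^^ r) s) ((rho ^^ r) u))"
proof (induction r)
  case (Suc r)
  show ?case
  proof (cases "(\<exists>q. r = Suc q \<and> (rho ^^ q) s = leaf) \<and> (rho ^^ r) u = leaf")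
    case True
    then have "(rho ^^ r) s = leaf" by auto
    with True Suc show ?thesis by simp
  next
    case False
    with Suc show ?thesis by (simp add: rho_graft)
  qed
qed simp

section \<open>Old leaves and the remaining nodes\<close>

lemma old_leaves_Node:
  "old_leaves (Node ts) =
     (if ts \<noteq> [] \<and> hd ts = leaf then {[0]} else {}) \<union> (\<Union>i<length ts. (#) i ` old_leaves (ts ! i))"
proof (rule set_eqI)
  fix v
  show "v \<in> old_leaves (Node ts) \<longleftrightarrow> v \<in> (if ts \<noteq> [] \<and> hd ts = leaf then {[0]} else {}) \<union>
          (\<Union>i<length ts. (#) i ` old_leaves (ts ! i))"
  proof (cases v)
    case (Cons i w)
    then show ?thesis
      by (cases "w = []") (auto simp: old_leaves_def nodes_def hd_conv_nth intro!: gr0I split: if_splits)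
  qed (auto simp: old_leaves_def)
qed

lemma finite_old_leaves [simp]: "finite (old_leaves t)"
  by (rule finite_subset[OF _ finite_nodes[of t]]) (auto simp: old_leaves_def)

lemma card_old_leaves_Node:
  "card (old_leaves (Node ts)) =
     (if ts \<noteq> [] \<and> hd ts = leaf then 1 else 0) + (\<Sum>t\<leftarrow>ts. card (old_leaves t))"
proof -
  have "card (\<Union>i<length ts. (#) i ` old_leaves (ts ! i))
          = (\<Sum>i<length ts. card ((#) i ` old_leaves (ts ! i)))"
    by (rule card_UN_disjoint) auto
  also have "\<dots> = (\<Sum>t\<leftarrow>ts. card (old_leaves t))"
    by (simp add: card_image sum_list_sum_nth atLeast0LessThan)
  finally have below: "card (\<Union>i<length ts. (#) i ` old_leaves (ts ! i)) = (\<Sum>t\<leftarrow>ts. card (old_leaves t))" .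
  have "[0] \<notin> (\<Union>i<length ts. (#) i ` old_leaves (ts ! i))"
    by (auto simp: old_leaves_def)
  with below show ?thesis
    unfolding old_leaves_Node by auto
qed

lemma card_old_leaves_leaf [simp]: "card (old_leaves leaf) = 0"
  by (simp add: card_old_leaves_Node)

lemma card_old_leaves_graft:
  "card (old_leaves (graft s u)) =
     card (old_leaves s) + card (old_leaves u) + (if s = leaf \<and> u = leaf then 1 else 0)"
proof (cases s)
  case (Node ts)
  then show ?thesis by (cases ts) (auto simp: graft_def card_old_leaves_Node)
qed

definition bullets :: "plane_tree \<Rightarrow> nat list set" where
  "bullets t = nodes t - (old_leaves t \<union> butlast ` old_leaves t)"

lemma subtree_append:
  "subtree t (v @ w) = (case subtree t v of None \<Rightarrow> None | Some s \<Rightarrow> subtree s w)"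
  by (induction t v rule: subtree.induct) auto

text \<open>
  An old leaf is determined by its parent and is not itself a parent, so old leaves and parents of
  old leaves are disjoint and equinumerous.
\<close>

lemma card_bullets: "card (bullets t) + 2 * card (old_leaves t) = tree_size t"
proof -
  let ?L = "old_leaves t"
  have snoc: "\<exists>w. v = w @ [0]" if "v \<in> ?L" for v
  proof -
    have "v = butlast v @ [0]"
      using that append_butlast_last_id[of v] by (auto simp: old_leaves_def)
    then show ?thesis ..
  qed
  have parent: "\<exists>s. subtree t w = Some s \<and> s \<noteq> leaf" if "w @ [0] \<in> ?L" for w
    using that by (cases "subtree t w") (auto simp: old_leaves_def nodes_def subtree_append)
  have inj: "inj_on butlast ?L"
    by (rule inj_onI) (metis snoc butlast_snoc)
  have sub: "?L \<subseteq> nodes t" "butlast ` ?L \<subseteq> nodes t"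
    using snoc parent by (fastforce simp: old_leaves_def nodes_def)+
  have disj: "?L \<inter> butlast ` ?L = {}"
    using snoc parent by (fastforce simp: old_leaves_def)
  have "card (?L \<union> butlast ` ?L) = 2 * card ?L"
    using disj inj by (simp add: card_Un_disjoint card_image)
  moreover have "card (?L \<union> butlast ` ?L) \<le> card (nodes t)"
    using sub by (intro card_mono) (auto simp: finite_nodes)
  ultimately show ?thesis
    unfolding bullets_def tree_size_def using sub by (subst card_Diff_subset) auto
qed

lemma card_bullets_leaf [simp]: "card (bullets leaf) = 1"
  using card_bullets[of leaf] by simp

lemma card_bullets_graft:
  "card (bullets (graft s u)) = (if s = leaf \<and> u = leaf then 0 else card (bullets s) + card (bullets u))"
  using card_bullets[of "graft s u"] card_bullets[of s] card_bullets[of u]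
  by (auto simp: card_old_leaves_graft split: if_splits)

definition weight :: "'a::comm_ring_1 \<Rightarrow> 'a \<Rightarrow> plane_tree \<Rightarrow> 'a" where
  "weight x y t = x ^ card (old_leaves t) * y ^ card (bullets t)"

lemma weight_leaf [simp]: "weight x y leaf = y"
  by (simp add: weight_def)

text \<open>
  The exception arises because grafting a leaf onto a leaf creates an old leaf and its parent out of
  two nodes of the other kind.
\<close>

lemma weight_graft: "weight x y (graft s u) = (if s = leaf \<and> u = leaf then x else weight x y s * weight x y u)"
  by (auto simp: weight_def card_old_leaves_graft card_bullets_graft power_add)

section \<open>The weighted generating function\<close>

definition tree_gf :: "(plane_tree \<Rightarrow> 'a::comm_ring_1) \<Rightarrow> 'a fps" where
  "tree_gf f = Abs_fps (\<lambda>n. \<Sum>t | tree_size t = n. f t)"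

definition pair_gf :: "(plane_tree \<Rightarrow> plane_tree \<Rightarrow> 'a::comm_ring_1) \<Rightarrow> 'a fps" where
  "pair_gf f = Abs_fps (\<lambda>n. \<Sum>(s, u) | tree_size s + tree_size u = n. f s u)"

lemma tree_gf_nth: "tree_gf f $ n = (\<Sum>t | tree_size t = n. f t)"
  by (simp add: tree_gf_def)

lemma tree_gf_nth_0 [simp]: "tree_gf f $ 0 = 0"
  by (simp add: tree_gf_nth)

lemma pairs_eq_UN:
  "{(s, u). tree_size s + tree_size u = n} =
     (\<Union>i\<in>{0..n}. {t. tree_size t = i} \<times> {t. tree_size t = n - i})"
  by auto

lemma finite_pairs: "finite {(s, u). tree_size s + tree_size u = n}"
  unfolding pairs_eq_UN by (intro finite_UN_I finite_cartesian_product finite_plane_trees) auto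

lemma pair_gf_mult: "pair_gf (\<lambda>s u. f s * g u) = tree_gf f * tree_gf g"
proof (rule fps_ext)
  fix n
  have "pair_gf (\<lambda>s u. f s * g u) $ n =
          (\<Sum>i=0..n. \<Sum>(s, u)\<in>{t. tree_size t = i} \<times> {t. tree_size t = n - i}. f s * g u)"
    unfolding pair_gf_def fps_nth_Abs_fps pairs_eq_UN
    by (rule sum.UNION_disjoint) (auto simp: finite_plane_trees)
  also have "\<dots> = (tree_gf f * tree_gf g) $ n"
    by (simp add: fps_mult_nth tree_gf_nth sum_product sum.cartesian_product)
  finally show "pair_gf (\<lambda>s u. f s * g u) $ n = (tree_gf f * tree_gf g) $ n" .
qed

lemma pair_gf_add: "pair_gf (\<lambda>s u. f s u + g s u) = pair_gf f + pair_gf g"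
  by (rule fps_ext) (simp add: pair_gf_def sum.distrib case_prod_unfold)

lemma pair_gf_cmult: "pair_gf (\<lambda>s u. c * f s u) = fps_const c * pair_gf f"
  by (rule fps_ext) (simp add: pair_gf_def sum_distrib_left case_prod_unfold)

text \<open>
  The unique decomposition of a tree as a leaf or a grafting, read off as a functional equation.
\<close>

lemma tree_gf_eq: "tree_gf f = fps_const (f leaf) * fps_X + pair_gf (\<lambda>s u. f (graft s u))"
proof (rule fps_ext)
  fix n
  let ?P = "{(s, u). tree_size s + tree_size u = n}"
  have split: "{t. tree_size t = n} = (if n = 1 then {leaf} else {}) \<union> case_prod graft ` ?P"
  proof (intro set_eqI)
    fix t show "t \<in> {t. tree_size t = n} \<longleftrightarrow> t \<in> (if n = 1 then {leaf} else {}) \<union> case_prod graft ` ?P"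
      using leaf_or_graft[of t] by auto
  qed
  have inj: "inj_on (case_prod graft) ?P"
    by (auto simp: inj_on_def)
  have "(\<Sum>t | tree_size t = n. f t) = (\<Sum>t\<in>(if n = 1 then {leaf} else {}). f t) + (\<Sum>t\<in>case_prod graft ` ?P. f t)"
    unfolding split by (rule sum.union_disjoint) (auto simp: finite_pairs)
  also have "(\<Sum>t\<in>case_prod graft ` ?P. f t) = (\<Sum>(s, u)\<in>?P. f (graft s u))"
    by (subst sum.reindex[OF inj]) (simp add: case_prod_unfold)
  finally show "tree_gf f $ n = (fps_const (f leaf) * fps_X + pair_gf (\<lambda>s u. f (graft s u))) $ n"
    by (simp add: tree_gf_nth pair_gf_def)
qed

text \<open>
  Trees that \<open>r\<close> reductions turn into a single node. Their generating function \<open>collapsed_gf r\<close>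
  satisfies \<open>z\<^sub>0 = X\<close> and \<open>z\<^sub>r\<^sub>+\<^sub>1 = X / (1 - z\<^sub>r)\<close>, the recursion of the continued fraction that also
  counts plane trees of height at most \<open>r\<close>. It is stated over an arbitrary ring, since it is used both
  with real coefficients and with coefficients that depend on a marking variable.
\<close>

definition collapsed :: "nat \<Rightarrow> plane_tree \<Rightarrow> 'a::comm_ring_1" where
  "collapsed r t = (if (rho ^^ r) t = leaf then 1 else 0)"

definition collapsed_gf :: "nat \<Rightarrow> 'a::comm_ring_1 fps" where
  "collapsed_gf r = tree_gf (collapsed r)"

lemma collapsed_gf_0: "collapsed_gf 0 = fps_X"
  unfolding collapsed_gf_def by (subst tree_gf_eq) (simp add: collapsed_def pair_gf_def fps_eq_iff)

lemma collapsed_gf_Suc: "collapsed_gf (Suc r) = fps_X + collapsed_gf r * collapsed_gf (Suc r)"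
proof -
  have "collapsed (Suc r) (graft s u) = collapsed r s * (collapsed (Suc r) u :: 'a)" for s u
    unfolding collapsed_def funpow_rho_graft by auto
  then show ?thesis
    unfolding collapsed_gf_def
    by (subst tree_gf_eq) (simp add: pair_gf_mult, simp add: collapsed_def)
qed

text \<open>
  The weight of the \<open>r\<close>-fold reduction of \<open>graft s u\<close> is the product of the weights of the
  reductions of \<open>s\<close> and \<open>u\<close>, with two exceptions: if \<open>u\<close> is cut off the weight is \<open>y\<close>, and if both
  reduce to leaves without \<open>u\<close> being cut off it is \<open>x\<close>. The pairs with \<open>u\<close> cut off have generating
  function \<open>z\<^sub>r\<^sub>-\<^sub>1 * z\<^sub>r = z\<^sub>r - X\<close> (with \<open>z\<^sub>-\<^sub>1 = 0\<close>), which makes the corrections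
  expressible by \<open>z\<^sub>r\<close> alone.
\<close>

lemma weighted_tree_gf:
  fixes x y :: "'a::comm_ring_1" and r :: nat
  defines "F \<equiv> tree_gf (\<lambda>t. x ^ X_square r t * y ^ X_bullet r t)" and "z \<equiv> collapsed_gf r"
  shows "F - F\<^sup>2 = fps_const y * z - fps_const (y\<^sup>2) * z\<^sup>2 + fps_const x * (fps_X - z + z\<^sup>2)"
proof -
  define W where "W t = weight x y ((rho ^^ r) t)" for t
  have F: "F = tree_gf W"
    unfolding F_def W_def weight_def X_square_def X_bullet_def bullets_def Let_def ..
  \<comment> \<open>Marks the trees that collapse in \<open>r - 1\<close> steps; none of them for \<open>r = 0\<close>.\<close>
  define b :: "plane_tree \<Rightarrow> 'a" where
    "b t = (if \<exists>q. r = Suc q \<and> (rho ^^ q) t = leaf then 1 else 0)" for t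
  let ?c = "collapsed r :: plane_tree \<Rightarrow> 'a"
  have b: "fps_X + tree_gf b * z = z"
  proof (cases r)
    case 0
    then have "tree_gf b = 0" by (simp add: b_def tree_gf_def fps_eq_iff)
    with 0 show ?thesis by (simp add: z_def collapsed_gf_0)
  next
    case (Suc q)
    then have "b = collapsed q" by (simp add: b_def collapsed_def fun_eq_iff)
    then show ?thesis using collapsed_gf_Suc[of q, where 'a = 'a] by (simp add: z_def Suc collapsed_gf_def)
  qed
  have W: "W (graft s u) = W s * W u + ((y - x) * (b s * ?c u) + (x - y\<^sup>2) * (?c s * ?c u))" for s u
  proof -
    have "(\<exists>q. r = Suc q \<and> (rho ^^ q) s = leaf) \<Longrightarrow> (rho ^^ r) s = leaf" by auto
    then show ?thesis
      unfolding W_def funpow_rho_graft b_def collapsed_def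
      by (auto simp: weight_graft power2_eq_square)
  qed
  have "F = fps_const y * fps_X + (F * F +
          (fps_const (y - x) * (tree_gf b * z) + fps_const (x - y\<^sup>2) * (z * z)))"
    unfolding F z_def collapsed_gf_def
    by (subst tree_gf_eq) (simp add: W pair_gf_add pair_gf_cmult pair_gf_mult, simp add: W_def)
  moreover have "tree_gf b * z = z - fps_X"
    using b by (simp add: algebra_simps)
  ultimately have "F = fps_const y * fps_X + (F * F +
          (fps_const (y - x) * (z - fps_X) + fps_const (x - y\<^sup>2) * (z * z)))"
    by simp
  then have "F - F * F = fps_const y * fps_X +
          (fps_const (y - x) * (z - fps_X) + fps_const (x - y\<^sup>2) * (z * z))"
    by (simp add: algebra_simps)
  then show ?thesis
    by (simp add: power2_eq_square algebra_simps flip: fps_const_sub)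
qed

section \<open>Generating functions of binomial moments\<close>

text \<open>
  Marking a statistic \<open>N\<close> by \<open>1 + \<epsilon>\<close> makes the coefficient of \<open>\<epsilon>\<^sup>d\<close> the binomial moment of order
  \<open>d\<close>. The functional equation lives in series in the size variable with coefficients in \<open>\<epsilon>\<close>, whereas
  the Taylor expansion below needs series in \<open>\<epsilon>\<close> whose coefficients are series in the
  size variable. Exchanging the two is a ring homomorphism.
\<close>

definition swap_vars :: "'a::comm_ring_1 fps fps \<Rightarrow> 'a fps fps" where
  "swap_vars f = Abs_fps (\<lambda>d. Abs_fps (\<lambda>n. f $ n $ d))"

lemma swap_vars_nth [simp]: "swap_vars f $ d $ n = f $ n $ d"
  by (simp add: swap_vars_def)

lemma swap_vars_add: "swap_vars (f + g) = swap_vars f + swap_vars g"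
  by (intro fps_ext) simp

lemma swap_vars_diff: "swap_vars (f - g) = swap_vars f - swap_vars g"
  by (intro fps_ext) simp

lemma swap_vars_mult: "swap_vars (f * g) = swap_vars f * swap_vars g"
proof (intro fps_ext)
  fix d n
  have "swap_vars (f * g) $ d $ n = (\<Sum>i=0..n. \<Sum>j=0..d. f $ i $ j * g $ (n - i) $ (d - j))"
    by (simp add: fps_mult_nth fps_sum_nth)
  also have "\<dots> = (\<Sum>j=0..d. \<Sum>i=0..n. f $ i $ j * g $ (n - i) $ (d - j))"
    by (rule sum.swap)
  also have "\<dots> = (swap_vars f * swap_vars g) $ d $ n"
    by (simp add: fps_mult_nth fps_sum_nth)
  finally show "swap_vars (f * g) $ d $ n = (swap_vars f * swap_vars g) $ d $ n" .
qed

lemma swap_vars_X: "swap_vars fps_X = fps_const fps_X"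
  by (intro fps_ext) (auto simp: fps_X_def)

lemma swap_vars_const_X: "swap_vars (fps_const fps_X) = fps_X"
  by (intro fps_ext) (auto simp: fps_X_def)

lemma swap_vars_tree_gf: "swap_vars (tree_gf f) = Abs_fps (\<lambda>d. tree_gf (\<lambda>t. f t $ d))"
  by (intro fps_ext) (simp add: tree_gf_nth fps_sum_nth)

lemma swap_vars_collapsed_gf: "swap_vars (collapsed_gf r) = fps_const (collapsed_gf r)"
proof -
  have "collapsed r t $ d = (if d = 0 then collapsed r t else 0 :: 'a::comm_ring_1)" for t and d :: nat
    by (simp add: collapsed_def)
  then show ?thesis
    by (intro fps_ext) (simp add: collapsed_gf_def tree_gf_nth fps_sum_nth)
qed

lemma one_plus_X_power_nth: "(1 + fps_X) ^ n $ d = (of_nat (n choose d) :: 'a::comm_ring_1)"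
proof (induction n arbitrary: d)
  case 0
  then show ?case by (cases d) auto
next
  case (Suc n)
  then show ?case
    by (cases d) (simp_all add: fps_mult_fps_X_plus_1_nth del: of_nat_Suc)
qed

definition moment_gf :: "(plane_tree \<Rightarrow> nat) \<Rightarrow> real fps fps" where
  "moment_gf N = Abs_fps (\<lambda>d. tree_gf (\<lambda>t. of_nat (N t choose d)))"

lemma moment_gf_eq: "moment_gf N = swap_vars (tree_gf (\<lambda>t. (1 + fps_X) ^ N t))"
  by (simp add: moment_gf_def swap_vars_tree_gf one_plus_X_power_nth)

definition size_gf :: "real fps" where
  "size_gf = tree_gf (\<lambda>_. 1)"

lemma moment_gf_0: "moment_gf N $ 0 = size_gf"
  by (simp add: moment_gf_def size_gf_def)

lemma moment_gf_X_square:
  fixes r :: nat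
  defines "z \<equiv> collapsed_gf r"
  shows "moment_gf (X_square r) - (moment_gf (X_square r))\<^sup>2
           = fps_const fps_X + fps_X * fps_const (fps_X - z + z\<^sup>2)"
proof -
  let ?F = "tree_gf (\<lambda>t. (1 + fps_X :: real fps) ^ X_square r t)"
  let ?z = "collapsed_gf r :: real fps fps"
  have "?F - ?F * ?F = fps_X + fps_const fps_X * (fps_X - ?z + ?z * ?z)"
    using weighted_tree_gf[of "1 + fps_X :: real fps" r 1]
    by (simp add: algebra_simps power2_eq_square flip: fps_const_add)
  from arg_cong[OF this, of swap_vars] show ?thesis
    by (simp add: moment_gf_eq swap_vars_add swap_vars_diff swap_vars_mult swap_vars_X swap_vars_const_X
        swap_vars_collapsed_gf z_def power2_eq_square)
qed

lemma moment_gf_X_bullet: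
  fixes r :: nat
  defines "z \<equiv> collapsed_gf r"
  shows "moment_gf (X_bullet r) - (moment_gf (X_bullet r))\<^sup>2
           = fps_const fps_X + fps_X * (fps_const (z - 2 * z\<^sup>2) - fps_X * fps_const (z\<^sup>2))"
proof -
  let ?F = "tree_gf (\<lambda>t. (1 + fps_X :: real fps) ^ X_bullet r t)"
  let ?z = "collapsed_gf r :: real fps fps"
  let ?e = "fps_const fps_X :: real fps fps"
  have c1: "fps_const (1 + fps_X) = 1 + ?e"
    by (simp flip: fps_const_add)
  have c2: "fps_const ((1 + fps_X)\<^sup>2) = (1 + ?e)\<^sup>2"
    by (simp only: c1[symmetric] fps_const_mult power2_eq_square)
  have "?F - ?F\<^sup>2 = (1 + ?e) * ?z - (1 + ?e)\<^sup>2 * ?z\<^sup>2 + (fps_X - ?z + ?z\<^sup>2)"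
    using weighted_tree_gf[of 1 r "1 + fps_X :: real fps"]
    by (simp only: c1 c2 power_one mult_1 fps_const_1_eq_1)
  moreover have "(1 + e) * z - (1 + e)\<^sup>2 * z\<^sup>2 + (x - z + z\<^sup>2) = x + e * (z - (z * z + z * z) - e * (z * z))"
    for e x z :: "'b::comm_ring_1"
    by (simp add: algebra_simps power2_eq_square)
  ultimately have "?F - ?F * ?F = fps_X + ?e * (?z - (?z * ?z + ?z * ?z) - ?e * (?z * ?z))"
    by (simp only: power2_eq_square)
  from arg_cong[OF this, of swap_vars] show ?thesis
    by (simp only: moment_gf_eq swap_vars_add swap_vars_diff swap_vars_mult swap_vars_X swap_vars_const_X
        swap_vars_collapsed_gf z_def power2_eq_square fps_const_mult fps_const_add fps_const_sub mult_2)
qed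

lemma size_gf_quadratic: "size_gf - size_gf\<^sup>2 = fps_X"
  using weighted_tree_gf[of "1::real" 0 1] by (simp add: size_gf_def)

lemma size_gf_nth_0 [simp]: "size_gf $ 0 = 0"
  by (simp add: size_gf_def)

section \<open>Taylor expansion of the generating function of plane trees\<close>

text \<open>
  \<open>taylor f\<close> is \<open>f (X + \<epsilon>)\<close> as a series in \<open>\<epsilon>\<close>.
\<close>

definition taylor :: "real fps \<Rightarrow> real fps fps" where
  "taylor f = Abs_fps (\<lambda>j. fps_const (1 / fact j) * (fps_deriv ^^ j) f)"

lemma taylor_nth_0 [simp]: "taylor f $ 0 = f"
  by (simp add: taylor_def)

lemma taylor_deriv: "fps_deriv (taylor f) = taylor (fps_deriv f)"
proof (rule fps_ext)
  fix j
  have "of_nat (Suc j) * (fps_const (1 / fact (Suc j)) * (fps_deriv ^^ Suc j) f)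
         = fps_const (real (Suc j) / fact (Suc j)) * (fps_deriv ^^ Suc j) f"
    by (simp only: fps_of_nat[symmetric] mult.assoc[symmetric] fps_const_mult times_divide_eq_right mult_1_right)
  also have "real (Suc j) / fact (Suc j) = 1 / fact j"
    by (simp add: field_simps del: of_nat_Suc)
  finally show "fps_deriv (taylor f) $ j = taylor (fps_deriv f) $ j"
    by (simp add: taylor_def funpow_swap1)
qed

lemma fps_deriv_higher_add: "(fps_deriv ^^ j) (f + g) = (fps_deriv ^^ j) f + (fps_deriv ^^ j) (g :: real fps)"
  by (induction j) auto

lemma fps_deriv_higher_diff: "(fps_deriv ^^ j) (f - g) = (fps_deriv ^^ j) f - (fps_deriv ^^ j) (g :: real fps)"
  by (induction j) auto

lemma taylor_add: "taylor (f + g) = taylor f + taylor g"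
  by (rule fps_ext) (simp add: taylor_def fps_deriv_higher_add ring_distribs)

lemma taylor_diff: "taylor (f - g) = taylor f - taylor g"
  by (rule fps_ext) (simp add: taylor_def fps_deriv_higher_diff ring_distribs)

text \<open>
  The Leibniz rule for higher derivatives. Since differentiation in \<open>\<epsilon>\<close> and in \<open>X\<close> agree on Taylor
  series, it follows from the product rule by induction on the order, without binomial sums.
\<close>

lemma taylor_mult: "taylor (f * g) = taylor f * taylor g"
proof (rule fps_ext)
  fix d
  show "taylor (f * g) $ d = (taylor f * taylor g) $ d"
  proof (induction d arbitrary: f g)
    case (Suc d)
    have "of_nat (Suc d) * taylor (f * g) $ Suc d = fps_deriv (taylor (f * g)) $ d"
      by simp
    also have "\<dots> = taylor (f * fps_deriv g + fps_deriv f * g) $ d"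
      by (simp only: taylor_deriv fps_deriv_mult)
    also have "\<dots> = (taylor f * taylor (fps_deriv g) + taylor (fps_deriv f) * taylor g) $ d"
      by (simp add: taylor_add Suc)
    also have "\<dots> = fps_deriv (taylor f * taylor g) $ d"
      by (simp only: taylor_deriv[symmetric] fps_deriv_mult)
    also have "\<dots> = of_nat (Suc d) * (taylor f * taylor g) $ Suc d"
      by (simp only: fps_deriv_nth Suc_eq_plus1)
    finally show ?case
      by (metis mult_left_cancel of_nat_neq_0)
  qed simp
qed

lemma taylor_X: "taylor fps_X = fps_const fps_X + fps_X"
proof (rule fps_ext)
  fix j
  have "(fps_deriv ^^ Suc i) fps_X = (if i = 0 then 1 else 0 :: real fps)" for i
    by (induction i) auto
  then show "taylor fps_X $ j = (fps_const fps_X + fps_X :: real fps fps) $ j"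
    by (cases j) (auto simp: taylor_def fps_X_def simp del: funpow.simps)
qed

text \<open>
  The difference of the two roots, times one minus their sum, vanishes; the second factor
  is nonzero.
\<close>

lemma quadratic_root_unique:
  fixes F G :: "'a::idom fps"
  assumes "F - F\<^sup>2 = G - G\<^sup>2" "F $ 0 = G $ 0" "2 * F $ 0 \<noteq> 1"
  shows "F = G"
proof -
  have "(F - G) * (1 - F - G) = 0"
    using assms(1) by (simp add: algebra_simps power2_eq_square)
  moreover have "(1 - F - G) $ 0 \<noteq> 0"
    using assms(2,3) by (simp add: algebra_simps flip: mult_2)
  then have "1 - F - G \<noteq> 0" by auto
  ultimately show ?thesis by simp
qed

definition size_gf_deriv :: "nat \<Rightarrow> real fps" where
  "size_gf_deriv d = (fps_deriv ^^ d) size_gf"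

text \<open>
  With \<open>C = size_gf\<close>, the series \<open>C (X + \<epsilon> P)\<close> solves the quadratic equation
  assumed for the moment generating function and has the same constant term, so both agree. Expanding
  by Taylor in powers of \<open>\<epsilon> P\<close> and collecting powers of \<open>\<epsilon>\<close> gives the moments.
\<close>

theorem moment_gf_nth:
  fixes N :: "plane_tree \<Rightarrow> nat" and A B :: "real fps"
  defines "P \<equiv> fps_const A - fps_X * fps_const B"
  assumes eq: "moment_gf N - (moment_gf N)\<^sup>2 = fps_const fps_X + fps_X * P"
  shows "moment_gf N $ d = (\<Sum>j=0..d. fps_const (1 / fact j) * size_gf_deriv j * (P ^ j $ (d - j)))"
proof -
  define Q where "Q = fps_X * P"
  have Q0: "Q $ 0 = 0" by (simp add: Q_def)
  let ?T = "taylor size_gf oo Q"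
  have "taylor size_gf - taylor size_gf * taylor size_gf = fps_const fps_X + fps_X"
    using arg_cong[OF size_gf_quadratic, of taylor]
    by (simp add: taylor_diff taylor_mult taylor_X power2_eq_square)
  from arg_cong[OF this, of "\<lambda>f. f oo Q"] have T: "?T - ?T\<^sup>2 = fps_const fps_X + Q"
    using Q0 by (simp add: fps_compose_sub_distrib fps_compose_add_distrib fps_compose_mult_distrib
        power2_eq_square)
  have "2 * size_gf \<noteq> 1"
  proof
    assume "2 * size_gf = 1"
    from arg_cong[OF this, of "\<lambda>f. f $ 0"] show False by simp
  qed
  then have nz: "2 * moment_gf N $ 0 \<noteq> 1"
    by (simp only: moment_gf_0 not_False_eq_True)
  have "moment_gf N - (moment_gf N)\<^sup>2 = ?T - ?T\<^sup>2"
    by (simp only: eq T) (simp only: Q_def)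
  from quadratic_root_unique[OF this _ nz] have "moment_gf N = ?T"
    by (simp only: moment_gf_0 fps_compose_nth_0 taylor_nth_0)
  then have "moment_gf N $ d = (\<Sum>j=0..d. taylor size_gf $ j * (Q ^ j $ d))"
    by (simp only: fps_compose_nth)
  also have "\<dots> = (\<Sum>j=0..d. fps_const (1 / fact j) * size_gf_deriv j * (P ^ j $ (d - j)))"
  proof (rule sum.cong)
    fix j assume "j \<in> {0..d}"
    then have "Q ^ j $ d = P ^ j $ (d - j)"
      unfolding Q_def power_mult_distrib fps_X_power_mult_nth by simp
    then show "taylor size_gf $ j * (Q ^ j $ d) = fps_const (1 / fact j) * size_gf_deriv j * (P ^ j $ (d - j))"
      by (simp only: taylor_def size_gf_deriv_def fps_nth_Abs_fps)
  qed simp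
  finally show ?thesis .
qed

text \<open>
  The singular factor of \<open>size_gf = (1 - sqrt (1 - 4 X)) / 2\<close> and its square root
  \<open>1 - 2 size_gf\<close>.
\<close>

definition sing :: "real fps" where "sing = 1 - 4 * fps_X"

definition sqrt_sing :: "real fps" where "sqrt_sing = 1 - 2 * size_gf"

lemma sing_size_gf_deriv_1: "sing * size_gf_deriv 1 = sqrt_sing"
proof -
  have inv: "sqrt_sing * size_gf_deriv 1 = 1"
    using arg_cong[OF size_gf_quadratic, of fps_deriv]
    by (simp add: size_gf_deriv_def sqrt_sing_def power2_eq_square algebra_simps)
  have "sing = sqrt_sing * sqrt_sing"
    by (simp add: sing_def sqrt_sing_def power2_eq_square algebra_simps flip: size_gf_quadratic)
  then show ?thesis by (metis inv mult.assoc mult_1_right)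
qed

lemma fps_deriv_size_gf_deriv: "fps_deriv (size_gf_deriv d) = size_gf_deriv (Suc d)"
  by (simp add: size_gf_deriv_def)

lemma fps_deriv_sing: "fps_deriv (sing * f) = sing * fps_deriv f - 4 * f"
  by (simp add: sing_def algebra_simps)

text \<open>
  Up to a constant, \<open>size_gf_deriv d\<close> is \<open>sing\<close> to the power \<open>1/2 - d\<close>; so multiplication by \<open>sing\<close>
  lowers the order of the derivative by one.
\<close>

lemma sing_size_gf_deriv_Suc:
  assumes "d \<ge> 1"
  shows "sing * size_gf_deriv (Suc d) = fps_const (4 * real d - 2) * size_gf_deriv d"
  using assms
proof (induction d rule: dec_induct)
  case base
  have "sing * size_gf_deriv (Suc 1) - 4 * size_gf_deriv 1 = fps_deriv sqrt_sing"
    by (simp only: fps_deriv_sing[symmetric] fps_deriv_size_gf_deriv[symmetric] sing_size_gf_deriv_1)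
  also have "\<dots> = - 2 * size_gf_deriv 1"
    by (simp add: sqrt_sing_def size_gf_deriv_def)
  finally have "sing * size_gf_deriv (Suc 1) = (4 - 2) * size_gf_deriv 1"
    by (simp only: left_diff_distrib) (simp add: algebra_simps)
  then show ?case by (simp add: numeral_fps_const)
next
  case (step d)
  have "sing * size_gf_deriv (Suc (Suc d)) - 4 * size_gf_deriv (Suc d)
          = fps_deriv (sing * size_gf_deriv (Suc d))"
    by (simp only: fps_deriv_sing fps_deriv_size_gf_deriv)
  also have "\<dots> = fps_const (4 * real d - 2) * size_gf_deriv (Suc d)"
    by (simp add: step.IH fps_deriv_size_gf_deriv)
  finally have "sing * size_gf_deriv (Suc (Suc d)) - 4 * size_gf_deriv (Suc d)
          = fps_const (4 * real d - 2) * size_gf_deriv (Suc d)" .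
  then have "sing * size_gf_deriv (Suc (Suc d)) = (fps_const (4 * real d - 2) + 4) * size_gf_deriv (Suc d)"
    by (simp only: distrib_right diff_eq_eq)
  also have "fps_const (4 * real d - 2) + 4 = fps_const (4 * real (Suc d) - 2)"
    by (simp add: numeral_fps_const)
  finally show ?case .
qed

section \<open>Coefficient asymptotics at the dominant singularity\<close>

text \<open>
  Series that converge beyond the singularity \<open>1/4\<close> of the generating function of plane trees.
  Multiplying by them does not increase the order of growth of coefficients.
\<close>

definition subcritical :: "real fps \<Rightarrow> bool" where
  "subcritical f \<longleftrightarrow> fps_conv_radius f > ereal (1/4)"

lemma subcritical_const [simp]: "subcritical (fps_const c)" and subcritical_X [simp]: "subcritical fps_X"
  and subcritical_0 [simp]: "subcritical 0" and subcritical_1 [simp]: "subcritical 1" and subcritical_numeral [simp]: "subcritical (numeral k)"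
  by (simp_all add: subcritical_def)

lemma subcritical_add: "subcritical f \<Longrightarrow> subcritical g \<Longrightarrow> subcritical (f + g)"
  and subcritical_diff: "subcritical f \<Longrightarrow> subcritical g \<Longrightarrow> subcritical (f - g)"
  and subcritical_mult: "subcritical f \<Longrightarrow> subcritical g \<Longrightarrow> subcritical (f * g)"
  using fps_conv_radius_add[of f g] fps_conv_radius_diff[of f g] fps_conv_radius_mult[of f g]
  by (auto simp: subcritical_def min_def split: if_splits)

lemmas subcritical_intros = subcritical_add subcritical_diff subcritical_mult subcritical_const subcritical_X subcritical_1 subcritical_numeral

lemma subcritical_sum: "(\<And>i. i \<in> I \<Longrightarrow> subcritical (f i)) \<Longrightarrow> subcritical (\<Sum>i\<in>I. f i)"
  using subcritical_const[of 0] by (induction I rule: infinite_finite_induct) (auto intro: subcritical_add)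

lemma subcritical_power_nth:
  assumes "\<And>i. subcritical (P $ i)" shows "subcritical (P ^ j $ i)"
proof (induction j arbitrary: i)
  case 0
  show ?case using subcritical_const[of 0] by (cases i) auto
next
  case (Suc j)
  then show ?case by (auto simp: fps_mult_nth intro!: subcritical_sum subcritical_mult assms)
qed

text \<open>
  Choose \<open>R > 1/4\<close> inside the disc of convergence of \<open>g\<close>. As \<open>e\<close> grows by a factor tending to
  \<open>4 > 1 / R\<close>, the sequence \<open>e n * R ^ n\<close> is eventually increasing, so in the convolution
  \<open>h $ (n - i) * R ^ (n - i)\<close> is bounded by a multiple of \<open>e n * R ^ n\<close> uniformly in \<open>i\<close>. What remains
  is the convergent sum of \<open>\<bar>g $ i\<bar> * R ^ i\<close>.
\<close>

lemma subcritical_mult_bigo: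
  fixes e :: "nat \<Rightarrow> real"
  assumes g: "subcritical g" and h: "(\<lambda>n. h $ n) \<in> O(e)"
    and e: "eventually (\<lambda>n. e n > 0) sequentially"
    and lim: "(\<lambda>n. e n / e (Suc n)) \<longlonglongrightarrow> 1/4"
  shows "(\<lambda>n. (g * h) $ n) \<in> O(e)"
proof -
  from g obtain R where R: "1/4 < R" "ereal R < fps_conv_radius g"
    unfolding subcritical_def using ereal_dense2[of "ereal (1/4)" "fps_conv_radius g"] by auto
  have summ: "summable (\<lambda>n. \<bar>g $ n\<bar> * R ^ n)"
    using norm_summable_fps[of R g] R by (simp add: abs_mult)
  obtain H where H: "H > 0" "eventually (\<lambda>n. \<bar>h $ n\<bar> \<le> H * \<bar>e n\<bar>) sequentially"
    using h by (auto elim!: landau_o.bigE)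
  have "eventually (\<lambda>n. e n / e (Suc n) < R) sequentially"
    using order_tendstoD(2)[OF lim] R by blast
  moreover have "eventually (\<lambda>n. e (Suc n) > 0) sequentially"
    using e by (subst eventually_sequentially_Suc)
  ultimately have "eventually (\<lambda>n. e n > 0 \<and> \<bar>h $ n\<bar> \<le> H * e n \<and> e n \<le> R * e (Suc n)) sequentially"
    using e H(2) by eventually_elim (auto simp: field_simps)
  then obtain N where N: "\<And>n. n \<ge> N \<Longrightarrow> e n > 0 \<and> \<bar>h $ n\<bar> \<le> H * e n \<and> e n \<le> R * e (Suc n)"
    by (auto simp: eventually_sequentially)
  define u where "u n = e n * R ^ n" for n
  have u_pos: "u n > 0" if "n \<ge> N" for n
    using N[OF that] R by (simp add: u_def)
  have u_mono: "u m \<le> u n" if "N \<le> m" "m \<le> n" for m n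
    using that(2)
  proof (induction n rule: dec_induct)
    case (step n)
    have "e n * R ^ n \<le> R * e (Suc n) * R ^ n"
      using N[of n] step that R by (intro mult_right_mono) auto
    with step show ?case by (simp add: u_def mult_ac)
  qed simp
  \<comment> \<open>The finitely many indices below \<open>N\<close>, where \<open>e\<close> does not bound \<open>h\<close>, are absorbed into the constant.\<close>
  define M where "M = (\<Sum>m<N. \<bar>h $ m\<bar> * R ^ m)"
  define K where "K = H + M / u N"
  have M: "M \<ge> 0" using R by (simp add: M_def sum_nonneg)
  have hK: "\<bar>h $ m\<bar> * R ^ m \<le> K * u n" if "N \<le> n" "m \<le> n" for m n
  proof (cases "m \<ge> N")
    case True
    have "\<bar>h $ m\<bar> * R ^ m \<le> H * e m * R ^ m"
      using N[OF True] R by (intro mult_right_mono) auto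
    also have "\<dots> = H * u m" by (simp add: u_def)
    also have "\<dots> \<le> H * u n" using u_mono[OF True that(2)] H by simp
    also have "\<dots> \<le> K * u n" using M u_pos[of N] u_pos[OF that(1)] by (intro mult_right_mono) (auto simp: K_def)
    finally show ?thesis .
  next
    case False
    then have "\<bar>h $ m\<bar> * R ^ m \<le> M"
      unfolding M_def using R by (intro member_le_sum) auto
    also have "\<dots> = M / u N * u N" using u_pos[of N] by simp
    also have "\<dots> \<le> M / u N * u n" using M u_pos[of N] u_mono[of N n] that by (intro mult_left_mono) auto
    also have "\<dots> \<le> K * u n" using H u_pos[OF that(1)] by (intro mult_right_mono) (auto simp: K_def)
    finally show ?thesis .
  qed
  define G where "G = (\<Sum>n. \<bar>g $ n\<bar> * R ^ n)"
  have K: "K \<ge> 0" using M u_pos[of N] H by (simp add: K_def)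
  have "norm ((g * h) $ n) \<le> (G * K) * norm (e n)" if n: "n \<ge> N" for n
  proof -
    have "\<bar>(g * h) $ n\<bar> * R ^ n \<le> (\<Sum>i=0..n. \<bar>g $ i * h $ (n - i)\<bar>) * R ^ n"
      using R by (intro mult_right_mono) (auto simp: fps_mult_nth)
    also have "\<dots> = (\<Sum>i=0..n. (\<bar>g $ i\<bar> * R ^ i) * (\<bar>h $ (n - i)\<bar> * R ^ (n - i)))"
      unfolding sum_distrib_right
    proof (rule sum.cong)
      fix i assume "i \<in> {0..n}"
      then have "R ^ n = R ^ i * R ^ (n - i)" by (simp flip: power_add)
      then show "\<bar>g $ i * h $ (n - i)\<bar> * R ^ n = \<bar>g $ i\<bar> * R ^ i * (\<bar>h $ (n - i)\<bar> * R ^ (n - i))"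
        by (simp add: abs_mult)
    qed simp
    also have "\<dots> \<le> (\<Sum>i=0..n. (\<bar>g $ i\<bar> * R ^ i) * (K * u n))"
      using R n by (intro sum_mono mult_left_mono hK) auto
    also have "\<dots> = (\<Sum>i\<in>{0..n}. \<bar>g $ i\<bar> * R ^ i) * (K * u n)"
      by (simp add: sum_distrib_right)
    also have "\<dots> \<le> G * (K * u n)"
      unfolding G_def using R K u_pos[OF n] by (intro mult_right_mono sum_le_suminf summ) auto
    finally have "\<bar>(g * h) $ n\<bar> * R ^ n \<le> (G * K * e n) * R ^ n"
      by (simp add: u_def mult_ac)
    then have "\<bar>(g * h) $ n\<bar> \<le> G * K * e n"
      using R by (simp add: mult_le_cancel_right)
    with N[OF n] show ?thesis by simp
  qed
  then show ?thesis
    by (intro bigoI[of _ "G * K"]) (auto simp: eventually_sequentially)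
qed

definition num_trees :: "nat \<Rightarrow> real" where "num_trees n = size_gf $ n"

lemma num_trees_eq_card: "num_trees n = real (card {t. tree_size t = n})"
  by (simp add: num_trees_def size_gf_def tree_gf_nth)

lemma num_trees_pos: "n \<ge> 1 \<Longrightarrow> num_trees n > 0"
  using plane_trees_nonempty[of n] finite_plane_trees[of n] by (simp add: num_trees_eq_card card_gt_0_iff)

lemma subcritical_sing [simp]: "subcritical sing"
  by (simp add: sing_def numeral_fps_const subcritical_intros)

lemma sing_mult_nth: "(sing * f) $ Suc n = f $ Suc n - 4 * f $ n"
  by (simp add: sing_def algebra_simps numeral_fps_const)

text \<open>
  The recursion of the Catalan numbers, read off from the differential equation
  \<open>sing * C' = sqrt_sing\<close> for \<open>C = size_gf\<close>.
\<close>

lemma num_trees_Suc: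
  assumes "n \<ge> 1" shows "real (Suc n) * num_trees (Suc n) = (4 * real n - 2) * num_trees n"
proof -
  obtain m where m: "n = Suc m" using assms by (cases n) auto
  have "(sing * size_gf_deriv 1) $ n = sqrt_sing $ n"
    by (simp only: sing_size_gf_deriv_1)
  then show ?thesis
    unfolding m sing_mult_nth by (simp add: sqrt_sing_def size_gf_deriv_def num_trees_def numeral_fps_const algebra_simps)
qed

lemma num_trees_ratio: 
  assumes "n \<ge> 1" shows "num_trees n / num_trees (Suc n) = real (Suc n) / (4 * real n - 2)"
  using num_trees_Suc[OF assms] num_trees_pos[OF assms] num_trees_pos[of "Suc n"] assms by (simp add: field_simps)

lemma subcritical_mult_bigo_num_trees:
  fixes q :: "nat \<Rightarrow> real"
  assumes g: "subcritical g" and h: "(\<lambda>n. h $ n / num_trees n) \<in> O(q)"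
    and q: "\<And>n. n \<ge> 1 \<Longrightarrow> q n > 0" "(\<lambda>n. q n / q (Suc n)) \<longlonglongrightarrow> 1"
  shows "(\<lambda>n. (g * h) $ n / num_trees n) \<in> O(q)"
proof -
  let ?e = "\<lambda>n. num_trees n * q n"
  have pos: "eventually (\<lambda>n. num_trees n > 0 \<and> q n > 0) sequentially"
    using eventually_ge_at_top[of 1] by eventually_elim (use q num_trees_pos in auto)
  have "(\<lambda>n. num_trees n * (h $ n / num_trees n)) \<in> O(?e)"
    by (intro landau_o.big.mult h landau_o.big_refl)
  also have "?this \<longleftrightarrow> (\<lambda>n. h $ n) \<in> O(?e)"
    by (intro landau_o.big.in_cong eventually_mono[OF pos]) auto
  finally have h': "(\<lambda>n. h $ n) \<in> O(?e)" .
  have "(\<lambda>n. real (Suc n) / (4 * real n - 2)) \<longlonglongrightarrow> 1/4"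
    by real_asymp
  from tendsto_mult[OF this q(2)]
  have "(\<lambda>n. real (Suc n) / (4 * real n - 2) * (q n / q (Suc n))) \<longlonglongrightarrow> 1/4" by simp
  also have "?this \<longleftrightarrow> (\<lambda>n. ?e n / ?e (Suc n)) \<longlonglongrightarrow> 1/4"
    by (intro tendsto_cong eventually_mono[OF eventually_ge_at_top[of 1]])
      (simp only: times_divide_times_eq[symmetric] num_trees_ratio)
  finally have lim: "(\<lambda>n. ?e n / ?e (Suc n)) \<longlonglongrightarrow> 1/4" .
  have "(\<lambda>n. (g * h) $ n) \<in> O(?e)"
    by (rule subcritical_mult_bigo[OF g h' _ lim]) (use pos in eventually_elim, auto)
  then have "(\<lambda>n. (g * h) $ n / num_trees n) \<in> O(\<lambda>n. ?e n / num_trees n)"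
    by (intro landau_o.big.divide_right) (auto intro: eventually_mono[OF pos])
  also have "O(\<lambda>n. ?e n / num_trees n) = O(q)"
    by (intro landau_o.big.cong eventually_mono[OF pos]) auto
  finally show ?thesis .
qed

text \<open>
  Differentiation multiplies the coefficient of index \<open>n + i + 1\<close> by \<open>n + i + 1\<close>; the Catalan recursion
  turns this factor into \<open>4 (n + i) - 2\<close> while lowering the index of \<open>num_trees\<close> by one.
\<close>

lemma size_gf_deriv_nth:
  assumes "n \<ge> 1"
  shows "size_gf_deriv d $ n = num_trees n * (\<Prod>i<d. 4 * real (n + i) - 2)"
  using assms
proof (induction d arbitrary: n)
  case 0
  then show ?case by (simp add: size_gf_deriv_def num_trees_def)
next
  case (Suc d)
  have "size_gf_deriv (Suc d) $ n = real (Suc n) * size_gf_deriv d $ Suc n"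
    by (simp flip: fps_deriv_size_gf_deriv)
  also have "\<dots> = (real (Suc n) * num_trees (Suc n)) * (\<Prod>i<d. 4 * real (Suc n + i) - 2)"
    by (simp add: Suc.IH)
  also have "\<dots> = num_trees n * ((4 * real n - 2) * (\<Prod>i<d. 4 * real (n + Suc i) - 2))"
    using num_trees_Suc[OF Suc.prems] by simp
  also have "(4 * real n - 2) * (\<Prod>i<d. 4 * real (n + Suc i) - 2) = (\<Prod>i<Suc d. 4 * real (n + i) - 2)"
    by (subst prod.lessThan_Suc_shift) simp
  finally show ?case .
qed

lemma prod_bigo: "(\<lambda>n. (\<Prod>i<Suc d. 4 * real (n + i) - 2) - 4 ^ Suc d * real n ^ Suc d) \<in> O(\<lambda>n. real n ^ d)"
proof (induction d)
  case 0
  show ?case by simp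
next
  case (Suc d)
  let ?p = "\<lambda>n. \<Prod>i<Suc d. 4 * real (n + i) - 2"
  have eq: "(\<lambda>n. (\<Prod>i<Suc (Suc d). 4 * real (n + i) - 2) - 4 ^ Suc (Suc d) * real n ^ Suc (Suc d)) =
     (\<lambda>n. (4 * real (n + Suc d) - 2) * (?p n - 4 ^ Suc d * real n ^ Suc d)
            + 4 ^ Suc d * (4 * real (Suc d) - 2) * real n ^ Suc d)"
    by (simp add: algebra_simps)
  have "(\<lambda>n. 4 * real (n + Suc d) - 2) \<in> O(\<lambda>n. real n)" by real_asymp
  then have "(\<lambda>n. (4 * real (n + Suc d) - 2) * (?p n - 4 ^ Suc d * real n ^ Suc d)) \<in> O(\<lambda>n. real n * real n ^ d)"
    by (intro landau_o.big.mult Suc)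
  then show ?case
    unfolding eq by (intro sum_in_bigo) simp_all
qed

lemma size_gf_deriv_bigo: "(\<lambda>n. size_gf_deriv d $ n / num_trees n) \<in> O(\<lambda>n. real n ^ d)"
proof -
  have "(\<lambda>n. \<Prod>i<d. 4 * real (n + i) - 2) \<in> O(\<lambda>n. real n ^ d)"
  proof (induction d)
    case (Suc d)
    have "(\<lambda>n. 4 * real (n + d) - 2) \<in> O(\<lambda>n. real n)" by real_asymp
    from landau_o.big.mult[OF Suc this] show ?case by (simp add: mult.commute)
  qed simp
  also have "?this \<longleftrightarrow> ?thesis"
    by (intro landau_o.big.in_cong eventually_mono[OF eventually_ge_at_top[of 1]])
       (use num_trees_pos in \<open>force simp: size_gf_deriv_nth\<close>)
  finally show ?thesis .
qed

lemma subcritical_mult_size_gf_deriv_bigo: "subcritical g \<Longrightarrow> (\<lambda>n. (size_gf_deriv d * g) $ n / num_trees n) \<in> O(\<lambda>n. real n ^ d)"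
proof -
  assume g: "subcritical g"
  have "(\<lambda>n. (real n / real (Suc n)) ^ d) \<longlonglongrightarrow> 1 ^ d"
    by (intro tendsto_power) real_asymp
  then have "(\<lambda>n. real n ^ d / real (Suc n) ^ d) \<longlonglongrightarrow> 1"
    by (simp add: power_divide)
  from subcritical_mult_bigo_num_trees[OF g size_gf_deriv_bigo _ this] show ?thesis
    by (simp add: mult.commute)
qed

lemma sqrt_sing_nth: "n \<ge> 1 \<Longrightarrow> sqrt_sing $ n = - 2 * num_trees n"
  by (simp add: sqrt_sing_def num_trees_def numeral_fps_const)

lemma subcritical_mult_sqrt_sing_bigo:
  assumes "subcritical g" shows "(\<lambda>n. (sqrt_sing * g) $ n / num_trees n) \<in> O(\<lambda>n. 1)"
proof -
  have "(\<lambda>n. sqrt_sing $ n / num_trees n) \<in> O(\<lambda>n. 1 :: real)"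
  proof (rule bigoI[of _ 2])
    show "eventually (\<lambda>n. norm (sqrt_sing $ n / num_trees n) \<le> 2 * norm (1::real)) sequentially"
      using eventually_ge_at_top[of 1] by eventually_elim (use num_trees_pos in \<open>force simp: sqrt_sing_nth\<close>)
  qed
  from subcritical_mult_bigo_num_trees[OF assms this] show ?thesis by (simp add: mult.commute)
qed

text \<open>
  \<open>sing * sqrt_sing\<close> is the power \<open>3/2\<close> of \<open>sing\<close>, hence its coefficients are smaller than the number
  of trees by one order of \<open>n\<close>. This gives the error term \<open>O(1/n)\<close> of the expectations.
\<close>

lemma subcritical_mult_sing_sqrt_sing_bigo:
  assumes "subcritical g" shows "(\<lambda>n. (sing * sqrt_sing * g) $ n / num_trees n) \<in> O(\<lambda>n. 1 / real n)"
proof -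
  have "(\<lambda>n. - 2 + 8 * (real n / (4 * real n - 6))) \<in> O(\<lambda>n. 1 / real n)"
    by real_asymp
  also have "?this \<longleftrightarrow> (\<lambda>n. (sing * sqrt_sing) $ n / num_trees n) \<in> O(\<lambda>n. 1 / real n)"
  proof (intro landau_o.big.in_cong eventually_mono[OF eventually_ge_at_top[of 2]])
    fix n :: nat assume "n \<ge> 2"
    then obtain m where m: "n = Suc m" "m \<ge> 1" by (cases n) auto
    have "(sing * sqrt_sing) $ n = - 2 * num_trees n + 8 * num_trees m"
      using m by (simp add: sing_mult_nth sqrt_sing_nth)
    then have "(sing * sqrt_sing) $ n / num_trees n = - 2 + 8 * (num_trees m / num_trees n)"
      using num_trees_pos[of n] m by (simp add: field_simps)
    also have "num_trees m / num_trees n = real n / (4 * real n - 6)"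
      using num_trees_ratio[OF m(2)] m by (simp add: algebra_simps)
    finally show "- 2 + 8 * (real n / (4 * real n - 6)) = (sing * sqrt_sing) $ n / num_trees n" ..
  qed
  finally have *: "(\<lambda>n. (sing * sqrt_sing) $ n / num_trees n) \<in> O(\<lambda>n. 1 / real n)" .
  have "(\<lambda>n. (1 / real n) / (1 / real (Suc n))) \<longlonglongrightarrow> 1" by real_asymp
  from subcritical_mult_bigo_num_trees[OF assms * _ this] show ?thesis by (simp add: mult.commute)
qed

text \<open>
  The expansion around \<open>1/4\<close> to first order in the local parameter \<open>sing\<close>.
\<close>

definition expands :: "real fps \<Rightarrow> real \<Rightarrow> real \<Rightarrow> bool" where
  "expands f a b \<longleftrightarrow> (\<exists>g. subcritical g \<and> f = fps_const a + fps_const b * sing + sing\<^sup>2 * g)"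

lemma expands_imp_subcritical: "expands f a b \<Longrightarrow> subcritical f"
  by (auto simp: expands_def power2_eq_square intro!: subcritical_intros subcritical_sing)

lemma expands_const: "expands (fps_const c) c 0"
  unfolding expands_def by (rule exI[of _ 0]) simp

lemma expands_X: "expands fps_X (1/4) (-1/4)"
proof -
  have "fps_const (1/4) + fps_const (-1/4) * sing = (fps_X :: real fps)"
    by (rule fps_ext) (auto simp: sing_def numeral_fps_const fps_X_def)
  then show ?thesis
    unfolding expands_def by (intro exI[of _ 0]) simp
qed

lemma expands_add: assumes "expands f a b" "expands f' a' b'" shows "expands (f + f') (a + a') (b + b')"
proof -
  from assms obtain g g' where "subcritical g" "subcritical g'"
     "f = fps_const a + fps_const b * sing + sing\<^sup>2 * g" "f' = fps_const a' + fps_const b' * sing + sing\<^sup>2 * g'"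
    by (auto simp: expands_def)
  then show ?thesis
    unfolding expands_def
    by (intro exI[of _ "g + g'"]) (simp add: subcritical_add algebra_simps flip: fps_const_add)
qed

lemma expands_mult: assumes "expands f a b" "expands f' a' b'" shows "expands (f * f') (a * a') (a * b' + b * a')"
proof -
  from assms obtain g g' where *: "subcritical g" "subcritical g'"
     "f = fps_const a + fps_const b * sing + sing\<^sup>2 * g" "f' = fps_const a' + fps_const b' * sing + sing\<^sup>2 * g'"
    by (auto simp: expands_def)
  have alg: "(a + b * s + s\<^sup>2 * g) * (a' + b' * s + s\<^sup>2 * g') =
     a * a' + (a * b' + b * a') * s + s\<^sup>2 * (b * b' + (a + b * s) * g' + (a' + b' * s + s * s * g') * g)"
    for a b a' b' g g' s :: "real fps"
    by (simp add: algebra_simps power2_eq_square)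
  define A A' B B' where "A = fps_const a" "A' = fps_const a'" "B = fps_const b" "B' = fps_const b'"
  have "subcritical (B * B' + (A + B * sing) * g' + (A' + B' * sing + sing * sing * g') * g)"
    using * unfolding A_A'_B_B'_def by (intro subcritical_intros subcritical_sing)
  moreover have "f * f' = fps_const (a * a') + fps_const (a * b' + b * a') * sing
      + sing\<^sup>2 * (B * B' + (A + B * sing) * g' + (A' + B' * sing + sing * sing * g') * g)"
    unfolding * by (simp only: alg A_A'_B_B'_def fps_const_mult fps_const_add)
  ultimately show ?thesis
    unfolding expands_def by blast
qed

lemma expands_power: "expands f a b \<Longrightarrow> expands (f ^ d) (a ^ d) (real d * a ^ (d - 1) * b)"
proof (induction d)
  case 0
  then show ?case using expands_const[of 1] by simp
next
  case (Suc d)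
  from expands_mult[OF Suc.prems Suc.IH[OF Suc.prems]] show ?case
    by (cases d) (simp_all add: algebra_simps)
qed

text \<open>
  In the expansion of \<open>f\<close>, the constant contributes \<open>size_gf_deriv 1\<close>, the linear term \<open>sqrt_sing\<close>
  and the rest \<open>sing * sqrt_sing\<close> times a subcritical series.
\<close>

lemma mean_bigo:
  assumes "expands f a b"
  shows "(\<lambda>n. (size_gf_deriv 1 * f) $ n / num_trees n - (a * (4 * real n - 2) - 2 * b)) \<in> O(\<lambda>n. 1 / real n)"
proof -
  from assms obtain g where g: "subcritical g" "f = fps_const a + fps_const b * sing + sing\<^sup>2 * g"
    by (auto simp: expands_def)
  have "size_gf_deriv 1 * f = fps_const a * size_gf_deriv 1 + fps_const b * (sing * size_gf_deriv 1) + sing * (sing * size_gf_deriv 1) * g"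
    unfolding g by (simp only: algebra_simps power2_eq_square)
  then have eq: "size_gf_deriv 1 * f = fps_const a * size_gf_deriv 1 + fps_const b * sqrt_sing + sing * sqrt_sing * g"
    by (simp only: sing_size_gf_deriv_1)
  have "(\<lambda>n. (size_gf_deriv 1 * f) $ n / num_trees n - (a * (4 * real n - 2) - 2 * b)) \<in> O(\<lambda>n. 1 / real n)
          \<longleftrightarrow> (\<lambda>n. (sing * sqrt_sing * g) $ n / num_trees n) \<in> O(\<lambda>n. 1 / real n)"
  proof (intro landau_o.big.in_cong eventually_mono[OF eventually_ge_at_top[of 1]])
    fix n :: nat assume n: "n \<ge> 1"
    show "(size_gf_deriv 1 * f) $ n / num_trees n - (a * (4 * real n - 2) - 2 * b) = (sing * sqrt_sing * g) $ n / num_trees n"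
      using num_trees_pos[OF n] n unfolding eq by (simp add: size_gf_deriv_nth sqrt_sing_nth field_simps)
  qed
  with subcritical_mult_sing_sqrt_sing_bigo[OF g(1)] show ?thesis by blast
qed

lemma second_bigo:
  assumes "expands f a b"
  shows "(\<lambda>n. (size_gf_deriv 2 * f) $ n / num_trees n - (16 * a * real n ^ 2 + 8 * b * real n)) \<in> O(\<lambda>n. 1)"
proof -
  from assms obtain g where g: "subcritical g" "f = fps_const a + fps_const b * sing + sing\<^sup>2 * g"
    by (auto simp: expands_def)
  have k2: "sing * size_gf_deriv 2 = fps_const 2 * size_gf_deriv 1"
    using sing_size_gf_deriv_Suc[of 1] by (simp add: numeral_2_eq_2)
  have "size_gf_deriv 2 * f = fps_const a * size_gf_deriv 2 + fps_const b * (sing * size_gf_deriv 2) + sing * (sing * size_gf_deriv 2) * g"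
    unfolding g by (simp only: algebra_simps power2_eq_square)
  also have "\<dots> = fps_const a * size_gf_deriv 2 + fps_const b * (fps_const 2 * size_gf_deriv 1) + fps_const 2 * ((sing * size_gf_deriv 1) * g)"
    unfolding k2 by (simp only: mult_ac)
  also have "\<dots> = fps_const a * size_gf_deriv 2 + fps_const (2 * b) * size_gf_deriv 1 + fps_const 2 * (sqrt_sing * g)"
    by (simp only: sing_size_gf_deriv_1 mult.assoc[symmetric] fps_const_mult mult.commute[of b 2])
  finally have eq: "size_gf_deriv 2 * f = fps_const a * size_gf_deriv 2 + fps_const (2 * b) * size_gf_deriv 1 + fps_const 2 * (sqrt_sing * g)" .
  have "(\<lambda>n. (size_gf_deriv 2 * f) $ n / num_trees n - (16 * a * real n ^ 2 + 8 * b * real n)) \<in> O(\<lambda>n. 1)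
          \<longleftrightarrow> (\<lambda>n. 2 * ((sqrt_sing * g) $ n / num_trees n) - (4 * a + 4 * b)) \<in> O(\<lambda>n. 1)"
  proof (intro landau_o.big.in_cong eventually_mono[OF eventually_ge_at_top[of 1]])
    fix n :: nat assume n: "n \<ge> 1"
    show "(size_gf_deriv 2 * f) $ n / num_trees n - (16 * a * real n ^ 2 + 8 * b * real n) = 2 * ((sqrt_sing * g) $ n / num_trees n) - (4 * a + 4 * b)"
    proof -
      have "(size_gf_deriv 2 * f) $ n = a * size_gf_deriv 2 $ n + 2 * b * size_gf_deriv 1 $ n + 2 * (sqrt_sing * g) $ n"
        by (simp add: eq mult.assoc)
      moreover have "size_gf_deriv 2 $ n = num_trees n * (16 * real n ^ 2 - 4)" "size_gf_deriv 1 $ n = num_trees n * (4 * real n - 2)"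
        using size_gf_deriv_nth[OF n, of 2] size_gf_deriv_nth[OF n, of 1]
        by (simp_all add: numeral_2_eq_2 power2_eq_square algebra_simps)
      ultimately show ?thesis
        using num_trees_pos[OF n] by (simp only:) (simp add: field_simps)
    qed
  qed
  moreover have "(\<lambda>n. 2 * ((sqrt_sing * g) $ n / num_trees n) - (4 * a + 4 * b)) \<in> O(\<lambda>n. 1)"
  proof (rule sum_in_bigo(2))
    have "(\<lambda>n. 2 * ((sqrt_sing * g) $ n / num_trees n)) \<in> O(\<lambda>n. 1 * 1)"
      by (rule landau_o.big.mult[OF _ subcritical_mult_sqrt_sing_bigo[OF g(1)]]) simp
    then show "(\<lambda>n. 2 * ((sqrt_sing * g) $ n / num_trees n)) \<in> O(\<lambda>n. 1)" by (simp only: mult_1)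
  qed simp
  ultimately show ?thesis by blast
qed

lemma leading_bigo:
  assumes f: "expands f a b" and d: "d \<ge> 1"
  shows "(\<lambda>n. (size_gf_deriv d * f) $ n / num_trees n - 4 ^ d * a * real n ^ d) \<in> O(\<lambda>n. real n ^ (d - 1))"
proof -
  from d obtain m where m: "d = Suc m" by (cases d) auto
  from f obtain g where g: "subcritical g" "f = fps_const a + fps_const b * sing + sing\<^sup>2 * g"
    by (auto simp: expands_def)
  define h where "h = fps_const b + sing * g"
  have h: "subcritical h" by (auto simp: h_def intro!: subcritical_intros subcritical_sing g)
  have eq: "size_gf_deriv d * f = fps_const a * size_gf_deriv d + (sing * size_gf_deriv d) * h"
    unfolding g h_def by (simp only: algebra_simps power2_eq_square)
  have rest: "(\<lambda>n. ((sing * size_gf_deriv d) * h) $ n / num_trees n) \<in> O(\<lambda>n. real n ^ m)"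
  proof (cases "m = 0")
    case True
    then show ?thesis using subcritical_mult_sqrt_sing_bigo[OF h] m sing_size_gf_deriv_1 by simp
  next
    case False
    then have "(\<lambda>n. ((sing * size_gf_deriv d) * h) $ n / num_trees n) = (\<lambda>n. (4 * real m - 2) * ((size_gf_deriv m * h) $ n / num_trees n))"
      unfolding m by (simp add: sing_size_gf_deriv_Suc mult.assoc)
    moreover have "(\<lambda>n. (4 * real m - 2) * ((size_gf_deriv m * h) $ n / num_trees n)) \<in> O(\<lambda>n. 1 * real n ^ m)"
      by (rule landau_o.big.mult[OF _ subcritical_mult_size_gf_deriv_bigo[OF h, of m]]) simp
    ultimately show ?thesis by (simp only: mult_1)
  qed
  define p where "p n = (\<Prod>i<d. 4 * real (n + i) - 2)" for n
  have "(\<lambda>n. a * (p n - 4 ^ d * real n ^ d)) \<in> O(\<lambda>n. 1 * real n ^ m)"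
    unfolding p_def m by (rule landau_o.big.mult[OF _ prod_bigo]) simp
  then have main: "(\<lambda>n. a * (p n - 4 ^ d * real n ^ d)) \<in> O(\<lambda>n. real n ^ m)"
    by (simp only: mult_1)
  have "(\<lambda>n. a * (p n - 4 ^ d * real n ^ d) + ((sing * size_gf_deriv d) * h) $ n / num_trees n) \<in> O(\<lambda>n. real n ^ m)"
    by (rule sum_in_bigo(1)[OF main rest])
  also have "?this \<longleftrightarrow> (\<lambda>n. (size_gf_deriv d * f) $ n / num_trees n - 4 ^ d * a * real n ^ d) \<in> O(\<lambda>n. real n ^ m)"
  proof (intro landau_o.big.in_cong eventually_mono[OF eventually_ge_at_top[of 1]])
    fix n :: nat assume n: "n \<ge> 1"
    have "size_gf_deriv d $ n = num_trees n * p n"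
      using size_gf_deriv_nth[OF n] by (simp only: p_def)
    then show "a * (p n - 4 ^ d * real n ^ d) + ((sing * size_gf_deriv d) * h) $ n / num_trees n
        = (size_gf_deriv d * f) $ n / num_trees n - 4 ^ d * a * real n ^ d"
      using num_trees_pos[OF n] unfolding eq by (simp add: add_divide_distrib right_diff_distrib)
  qed
  finally show ?thesis by (simp only: m diff_Suc_1)
qed

section \<open>Expansion of the generating function of collapsing trees\<close>

text \<open>
  By continuity \<open>f\<close> still has a value below \<open>1\<close> at some \<open>R > 1/4\<close>. From \<open>v = 1 + f * v\<close> it follows
  by induction that \<open>\<bar>v $ n\<bar> * R ^ n \<le> 1\<close>: for \<open>n > 0\<close> the left-hand side is at most a weighted sum of earlier ones, with
  weights \<open>f $ i * R ^ i\<close> of total at most \<open>1\<close>.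
\<close>

lemma subcritical_inverse:
  assumes nonneg: "\<And>n. f $ n \<ge> 0" and f0: "f $ 0 = 0" and f: "subcritical f"
    and less: "eval_fps f (1/4) < 1" and v: "v * (1 - f) = 1"
  shows "subcritical v"
proof -
  from f have rad: "ereal (norm (1/4 :: real)) < fps_conv_radius f" by (simp add: subcritical_def)
  have "isCont (eval_fps f) (1/4)"
    using continuous_eval_fps[OF rad, of UNIV] by simp
  then have "eventually (\<lambda>x. eval_fps f x < 1) (at (1/4))"
    using less by (intro order_tendstoD) (auto simp: isCont_def)
  then obtain \<delta> where \<delta>: "\<delta> > 0" "\<And>x. x \<noteq> 1/4 \<Longrightarrow> dist x (1/4) < \<delta> \<Longrightarrow> eval_fps f x < 1"
    by (auto simp: eventually_at)
  obtain R0 where R0: "1/4 < R0" "ereal R0 < fps_conv_radius f"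
    using f ereal_dense2[of "ereal (1/4)" "fps_conv_radius f"] unfolding subcritical_def by auto
  define R where "R = min R0 (1/4 + \<delta>/2)"
  have R: "R > 1/4" "R \<le> R0" "dist R (1/4) < \<delta>"
    using R0 \<delta>(1) by (auto simp: R_def dist_real_def min_def)
  have radR: "ereal (norm R) < fps_conv_radius f"
  proof -
    have "ereal (norm R) \<le> ereal R0" using R by simp
    also note R0(2)
    finally show ?thesis .
  qed
  have total: "eval_fps f R < 1" using \<delta>(2) R by simp
  have partial: "(\<Sum>i\<in>{1..n}. f $ i * R ^ i) \<le> 1" for n
  proof -
    have "(\<Sum>i\<in>{1..n}. f $ i * R ^ i) \<le> eval_fps f R"
      unfolding eval_fps_def using R by (intro sum_le_suminf summable_fps radR) (auto intro!: mult_nonneg_nonneg nonneg)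
    with total show ?thesis by simp
  qed
  have rec: "v = 1 + f * v" using v by (simp add: algebra_simps)
  have bound: "\<bar>v $ n\<bar> * R ^ n \<le> 1" for n
  proof (induction n rule: less_induct)
    case (less n)
    show ?case
    proof (cases "n = 0")
      case True
      from rec have "v $ 0 = 1" using f0 by (metis add.right_neutral fps_mult_nth_0 fps_add_nth fps_one_nth mult_zero_left)
      with True show ?thesis by simp
    next
      case False
      have "v $ n = (f * v) $ n"
        using arg_cong[OF rec, of "\<lambda>f. f $ n"] False by simp
      also have "\<dots> = (\<Sum>i\<in>{1..n}. f $ i * v $ (n - i))"
        using f0 by (simp add: fps_mult_nth sum.atLeast_Suc_atMost)
      finally have "\<bar>v $ n\<bar> * R ^ n \<le> (\<Sum>i\<in>{1..n}. \<bar>f $ i * v $ (n - i)\<bar>) * R ^ n"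
        using R by (intro mult_right_mono) auto
      also have "\<dots> = (\<Sum>i\<in>{1..n}. (f $ i * R ^ i) * (\<bar>v $ (n - i)\<bar> * R ^ (n - i)))"
        unfolding sum_distrib_right
      proof (rule sum.cong)
        fix i assume "i \<in> {1..n}"
        then have "R ^ n = R ^ i * R ^ (n - i)" by (simp flip: power_add)
        then show "\<bar>f $ i * v $ (n - i)\<bar> * R ^ n = f $ i * R ^ i * (\<bar>v $ (n - i)\<bar> * R ^ (n - i))"
          using nonneg[of i] by (simp add: abs_mult)
      qed simp
      also have "\<dots> \<le> (\<Sum>i\<in>{1..n}. (f $ i * R ^ i) * 1)"
        using R nonneg False by (intro sum_mono mult_left_mono less) auto
      also have "\<dots> \<le> 1" using partial by simp
      finally show ?thesis .
    qed
  qed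
  define r where "r = (1/4 + R) / 2"
  have r: "1/4 < r" "r < R" using R by (auto simp: r_def field_simps)
  have "summable (\<lambda>n. v $ n * r ^ n)"
  proof (rule summable_comparison_test')
    show "summable (\<lambda>n. (r / R) ^ n)" using r by (intro summable_geometric) auto
    show "norm (v $ n * r ^ n) \<le> (r / R) ^ n" for n
    proof -
      have "norm (v $ n * r ^ n) = (\<bar>v $ n\<bar> * R ^ n) * (r / R) ^ n"
        using r by (simp add: abs_mult power_divide)
      also have "\<dots> \<le> 1 * (r / R) ^ n"
        using r by (intro mult_right_mono bound) auto
      finally show ?thesis by simp
    qed
  qed
  then have "ereal (norm r) \<le> fps_conv_radius v"
    unfolding fps_conv_radius_def by (rule conv_radius_geI)
  moreover have "ereal (1/4) < ereal (norm r)" using r by simp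
  ultimately show ?thesis unfolding subcritical_def by (rule less_le_trans[rotated])
qed

lemma expands_eval:
  assumes "expands f a b" shows "eval_fps f (1/4) = a"
proof -
  from assms obtain g where g: "subcritical g" "f = fps_const a + fps_const b * sing + sing\<^sup>2 * g"
    by (auto simp: expands_def)
  have f: "f = fps_const a + sing * (fps_const b + sing * g)"
    unfolding g by (simp only: algebra_simps power2_eq_square)
  have rad: "ereal (norm (1/4 :: real)) < fps_conv_radius h" "ereal (1/4) < fps_conv_radius h" if "subcritical h" for h
    using that by (simp_all add: subcritical_def)
  have sing: "eval_fps sing (1/4) = 0"
    unfolding sing_def numeral_fps_const
    by (simp add: eval_fps_diff eval_fps_mult rad subcritical_intros)
  have h: "subcritical (fps_const b + sing * g)" by (intro subcritical_intros subcritical_sing g)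
  show ?thesis
    unfolding f using h by (simp add: eval_fps_add eval_fps_mult rad sing subcritical_intros)
qed

lemma collapsed_gf_nth_nonneg: "(collapsed_gf r :: real fps) $ n \<ge> 0"
  by (auto simp: collapsed_gf_def tree_gf_nth collapsed_def intro!: sum_nonneg)

text \<open>
  The two equations on \<open>a'\<close> and \<open>b'\<close> say that \<open>(a' + b' * sing) * (1 - f)\<close> and
  \<open>X = (1 - sing) / 4\<close> agree up to a multiple of \<open>sing\<^sup>2\<close>. Multiplying by the subcritical inverse \<open>v\<close> of
  \<open>1 - f\<close> keeps this error subcritical.
\<close>

lemma expands_geometric:
  fixes f f' v :: "real fps"
  assumes f: "expands f a b" and f': "f' * (1 - f) = fps_X" and v: "v * (1 - f) = 1" "subcritical v"
    and a': "a' * (1 - a) = 1/4" and b': "b' * (1 - a) - a' * b = - 1/4"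
  shows "expands f' a' b'"
proof -
  from f obtain g where g: "subcritical g" "f = fps_const a + fps_const b * sing + sing\<^sup>2 * g"
    by (auto simp: expands_def)
  define A B A' B' where "A = fps_const a" "B = fps_const b" "A' = fps_const a'" "B' = fps_const b'"
  define G where "G = B * B' + (A' + B' * sing) * g"
  have X: "fps_X = fps_const (1/4) + fps_const (-1/4) * sing"
    by (rule fps_ext) (auto simp: sing_def numeral_fps_const fps_X_def)
  have A': "A' * (1 - A) = fps_const (1/4)" and B': "B' * (1 - A) - A' * B = fps_const (-1/4)"
    using arg_cong[OF a', of fps_const] arg_cong[OF b', of fps_const]
    by (simp_all add: A_B_A'_B'_def flip: fps_const_mult fps_const_sub)
  have alg: "(A' + B' * s) * (1 - (A + B * s + s\<^sup>2 * g)) + s\<^sup>2 * (B * B' + (A' + B' * s) * g)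
               = A' * (1 - A) + (B' * (1 - A) - A' * B) * s"
    for A B A' B' s g :: "real fps"
    by (simp add: algebra_simps power2_eq_square)
  have "fps_X = (A' + B' * sing) * (1 - f) + sing\<^sup>2 * G"
    unfolding G_def g(2) A_B_A'_B'_def(1,2)[symmetric] alg A' B' by (rule X)
  with f' have "f' * (1 - f) = (A' + B' * sing) * (1 - f) + sing\<^sup>2 * G" by simp
  then have "v * (f' * (1 - f)) = v * ((A' + B' * sing) * (1 - f) + sing\<^sup>2 * G)" by simp
  then have "f' * (v * (1 - f)) = (A' + B' * sing) * (v * (1 - f)) + sing\<^sup>2 * (v * G)"
    by (simp only: distrib_left mult_ac)
  then have "f' = A' + B' * sing + sing\<^sup>2 * (v * G)"
    by (simp only: v mult_1_right)
  moreover have "subcritical (v * G)"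
    unfolding G_def A_B_A'_B'_def by (intro subcritical_intros subcritical_sing g v)
  ultimately show ?thesis
    unfolding expands_def A_B_A'_B'_def by blast
qed

text \<open>
  The value at \<open>1/4\<close> is \<open>1/2 - 1 / (2 (r + 2)) < 1\<close>, so by the recursion \<open>z\<^sub>r\<^sub>+\<^sub>1 = X / (1 - z\<^sub>r)\<close> the
  radius of convergence stays above \<open>1/4\<close> for every \<open>r\<close>.
\<close>

lemma collapsed_gf_expands:
  "expands (collapsed_gf r) ((real r + 1) / (2 * (real r + 2))) (- ((real r + 1) * (real r + 3) / (6 * (real r + 2))))"
proof (induction r)
  case 0
  then show ?case using expands_X by (simp add: collapsed_gf_0)
next
  case (Suc r)
  let ?f = "collapsed_gf r :: real fps" and ?f' = "collapsed_gf (Suc r) :: real fps"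
  define v where "v = fps_shift 1 ?f'"
  have f': "?f' * (1 - ?f) = fps_X"
    using collapsed_gf_Suc[of r, where 'a = real] by (simp add: algebra_simps)
  have "?f' = fps_X * v"
    by (rule fps_ext) (simp add: v_def collapsed_gf_def)
  with f' have "fps_X * (v * (1 - ?f)) = fps_X * 1" by (simp only: mult.assoc mult_1_right)
  then have v: "v * (1 - ?f) = 1" by simp
  have "subcritical v"
  proof (rule subcritical_inverse[OF collapsed_gf_nth_nonneg _ _ _ v])
    show "collapsed_gf r $ 0 = (0::real)" by (simp add: collapsed_gf_def)
    show "subcritical ?f" using Suc by (rule expands_imp_subcritical)
    show "eval_fps ?f (1/4) < 1" by (simp add: expands_eval[OF Suc] field_simps)
  qed
  show ?case
  proof (rule expands_geometric[OF Suc f' v \<open>subcritical v\<close>])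
    have nz: "real r + 2 \<noteq> 0" "real r + 3 \<noteq> 0" by linarith+
    show "(real (Suc r) + 1) / (2 * (real (Suc r) + 2)) * (1 - (real r + 1) / (2 * (real r + 2))) = 1/4"
      using nz by (simp add: divide_simps) (simp add: algebra_simps)
    show "- ((real (Suc r) + 1) * (real (Suc r) + 3) / (6 * (real (Suc r) + 2))) * (1 - (real r + 1) / (2 * (real r + 2))) -
      (real (Suc r) + 1) / (2 * (real (Suc r) + 2)) * - ((real r + 1) * (real r + 3) / (6 * (real r + 2))) = - 1/4"
      using nz by (simp add: divide_simps) (simp add: algebra_simps power2_eq_square)
  qed
qed

section \<open>Asymptotics of expectation, variance and factorial moments\<close>

abbreviation (input) expect :: "nat \<Rightarrow> (plane_tree \<Rightarrow> real) \<Rightarrow> real" where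
  "expect n f \<equiv> measure_pmf.expectation (random_plane_tree n) f"

lemma expect_eq:
  assumes "n \<ge> 1"
  shows "expect n f = (\<Sum>t | tree_size t = n. f t) / num_trees n"
  unfolding random_plane_tree_def num_trees_eq_card
  using plane_trees_nonempty[OF assms] finite_plane_trees by (rule integral_pmf_of_set)

lemma expect_choose:
  assumes "n \<ge> 1"
  shows "expect n (\<lambda>t. real (N t choose d)) = moment_gf N $ d $ n / num_trees n"
  using assms by (simp add: expect_eq moment_gf_def tree_gf_nth)

lemma falling_fact_eq: "falling_fact (real m) d = fact d * real (m choose d)"
  using gbinomial_mult_fact[of d "real m"]
  by (simp add: falling_fact_def binomial_gbinomial atLeast0LessThan)

lemma integrable_random_plane_tree:
  assumes "n \<ge> 1"
  shows "integrable (measure_pmf (random_plane_tree n)) (f :: plane_tree \<Rightarrow> real)"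
  unfolding random_plane_tree_def
  using plane_trees_nonempty[OF assms] finite_plane_trees
  by (intro integrable_measure_pmf_finite) (simp add: set_pmf_of_set)

text \<open>
  From here on the binomial moments of \<open>N\<close> are those of \<open>C (X + \<epsilon> A - \<epsilon>\<^sup>2 B)\<close>; both statistics of the
  reduced tree are of this form.
\<close>

context
  fixes N :: "plane_tree \<Rightarrow> nat" and A B :: "real fps" and a b c c' :: real
  assumes eq: "moment_gf N - (moment_gf N)\<^sup>2 = fps_const fps_X + fps_X * (fps_const A - fps_X * fps_const B)"
    and A: "expands A a b" and B: "expands B c c'"
begin

lemma expectation_asymp: "(\<lambda>n. expect n (\<lambda>t. real (N t)) - (4 * a * real n - (2 * a + 2 * b))) \<in> O(\<lambda>n. 1 / real n)"
proof -
  have "moment_gf N $ 1 = size_gf_deriv 1 * A"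
    using moment_gf_nth[OF eq, of 1] by simp
  then have *: "expect n (\<lambda>t. real (N t)) = (size_gf_deriv 1 * A) $ n / num_trees n" if "n \<ge> 1" for n
    using expect_choose[OF that, of N 1] by simp
  have "(\<lambda>n. expect n (\<lambda>t. real (N t)) - (4 * a * real n - (2 * a + 2 * b))) \<in> O(\<lambda>n. 1 / real n) \<longleftrightarrow>
        (\<lambda>n. (size_gf_deriv 1 * A) $ n / num_trees n - (a * (4 * real n - 2) - 2 * b)) \<in> O(\<lambda>n. 1 / real n)"
    by (intro landau_o.big.in_cong eventually_mono[OF eventually_ge_at_top[of 1]]) (simp add: * algebra_simps)
  with mean_bigo[OF A] show ?thesis by blast
qed

text \<open>
  In the formula for the moments only the highest derivative of \<open>C\<close> matters; each lower one loses
  an order of \<open>n\<close>.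
\<close>

lemma factorial_moment_asymp:
  assumes "d \<ge> 1"
  shows "(\<lambda>n. expect n (\<lambda>t. falling_fact (real (N t)) d) - (4 * a) ^ d * real n ^ d) \<in> O(\<lambda>n. real n ^ (d - 1))"
proof -
  define P where "P = fps_const A - fps_X * fps_const B"
  have P0: "P $ 0 = A" by (simp add: P_def)
  have "subcritical (P $ i)" for i
    using expands_imp_subcritical[OF A] expands_imp_subcritical[OF B] subcritical_diff[of 0 B]
    by (cases i) (auto simp: P_def)
  then have P: "subcritical (P ^ j $ i)" for i j by (rule subcritical_power_nth)
  have top: "P ^ d $ 0 = A ^ d" by (simp add: fps_power_zeroth P0)
  define E where "E n = (\<Sum>j<d. fact d / fact j * ((size_gf_deriv j * (P ^ j $ (d - j))) $ n / num_trees n))" for n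
  have mom: "expect n (\<lambda>t. falling_fact (real (N t)) d) = (size_gf_deriv d * A ^ d) $ n / num_trees n + E n" if "n \<ge> 1" for n
  proof -
    have "{0..d} = insert d {..<d}" by auto
    then have "moment_gf N $ d = fps_const (1 / fact d) * (size_gf_deriv d * A ^ d)
            + (\<Sum>j<d. fps_const (1 / fact j) * (size_gf_deriv j * (P ^ j $ (d - j))))"
      using moment_gf_nth[OF eq, of d, folded P_def] by (simp add: top mult.assoc)
    then have "moment_gf N $ d $ n = (1 / fact d) * (size_gf_deriv d * A ^ d) $ n
            + (\<Sum>j<d. (1 / fact j) * (size_gf_deriv j * (P ^ j $ (d - j))) $ n)"
      by (simp add: fps_sum_nth)
    then have "fact d * (moment_gf N $ d $ n / num_trees n) = (size_gf_deriv d * A ^ d) $ n / num_trees n + E n"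
      by (simp add: E_def sum_distrib_left sum_divide_distrib add_divide_distrib distrib_left)
    with expect_choose[OF that, of N d] show ?thesis
      by (simp add: falling_fact_eq)
  qed
  have E: "E \<in> O(\<lambda>n. real n ^ (d - 1))"
    unfolding E_def
  proof (intro big_sum_in_bigo)
    fix j assume j: "j \<in> {..<d}"
    have "(\<lambda>n. fact d / fact j * ((size_gf_deriv j * (P ^ j $ (d - j))) $ n / num_trees n)) \<in> O(\<lambda>n. 1 * real n ^ j)"
      by (rule landau_o.big.mult[OF _ subcritical_mult_size_gf_deriv_bigo[OF P]]) simp
    also have "(\<lambda>n. 1 * real n ^ j) \<in> O(\<lambda>n. real n ^ (d - 1))"
    proof (rule bigoI[of _ 1])
      show "eventually (\<lambda>n. norm (1 * real n ^ j) \<le> 1 * norm (real n ^ (d - 1))) sequentially"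
        using eventually_ge_at_top[of 1] by eventually_elim (use j in \<open>auto intro: power_increasing\<close>)
    qed
    finally show "(\<lambda>n. fact d / fact j * ((size_gf_deriv j * (P ^ j $ (d - j))) $ n / num_trees n)) \<in> O(\<lambda>n. real n ^ (d - 1))" .
  qed
  have "(\<lambda>n. ((size_gf_deriv d * A ^ d) $ n / num_trees n - 4 ^ d * a ^ d * real n ^ d) + E n) \<in> O(\<lambda>n. real n ^ (d - 1))"
    by (rule sum_in_bigo(1)[OF leading_bigo[OF expands_power[OF A] assms] E])
  also have "?this \<longleftrightarrow> ?thesis"
    by (intro landau_o.big.in_cong eventually_mono[OF eventually_ge_at_top[of 1]])
       (simp add: mom power_mult_distrib)
  finally show ?thesis .
qed

text \<open>
  For the variance the terms of order \<open>n\<close> of the second factorial moment are needed as well. They come from the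
  linear term in the expansion of \<open>A\<^sup>2\<close> and from the leading term of \<open>B\<close>.
\<close>

lemma second_factorial_moment_asymp:
  "(\<lambda>n. expect n (\<lambda>t. falling_fact (real (N t)) 2) - (16 * a\<^sup>2 * real n ^ 2 + (16 * a * b - 8 * c) * real n)) \<in> O(\<lambda>n. 1)"
proof -
  have "moment_gf N $ 2 = fps_const (1/2) * (size_gf_deriv 2 * A\<^sup>2) - size_gf_deriv 1 * B"
    using moment_gf_nth[OF eq, of 2] by (simp add: numeral_2_eq_2 power2_eq_square mult.assoc)
  then have *: "expect n (\<lambda>t. falling_fact (real (N t)) 2) = (size_gf_deriv 2 * A\<^sup>2) $ n / num_trees n - 2 * ((size_gf_deriv 1 * B) $ n / num_trees n)"
    if "n \<ge> 1" for n
  proof -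
    have "moment_gf N $ 2 $ n = (size_gf_deriv 2 * A\<^sup>2) $ n / 2 - (size_gf_deriv 1 * B) $ n"
      by (simp add: \<open>moment_gf N $ 2 = _\<close>)
    then show ?thesis
      using expect_choose[OF that, of N 2] by (simp add: falling_fact_eq fact_2 diff_divide_distrib)
  qed
  have A2: "expands (A\<^sup>2) (a\<^sup>2) (2 * a * b)"
    using expands_power[OF A, of 2] by simp
  have 1: "(\<lambda>n. (size_gf_deriv 2 * A\<^sup>2) $ n / num_trees n - (16 * a\<^sup>2 * real n ^ 2 + 8 * (2 * a * b) * real n)) \<in> O(\<lambda>n. 1)"
    by (rule second_bigo[OF A2])
  have "(\<lambda>n. 2 * ((size_gf_deriv 1 * B) $ n / num_trees n - 4 ^ 1 * c * real n ^ 1)) \<in> O(\<lambda>n. 1 * real n ^ (1 - 1))"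
    by (rule landau_o.big.mult[OF _ leading_bigo[OF B]]) simp_all
  then have 2: "(\<lambda>n. 2 * ((size_gf_deriv 1 * B) $ n / num_trees n - 4 * c * real n)) \<in> O(\<lambda>n. 1)" by simp
  have "?thesis \<longleftrightarrow> (\<lambda>n. ((size_gf_deriv 2 * A\<^sup>2) $ n / num_trees n - (16 * a\<^sup>2 * real n ^ 2 + 8 * (2 * a * b) * real n))
          - 2 * ((size_gf_deriv 1 * B) $ n / num_trees n - 4 * c * real n)) \<in> O(\<lambda>n. 1)"
    by (intro landau_o.big.in_cong eventually_mono[OF eventually_ge_at_top[of 1]])
       (simp add: * algebra_simps)
  with sum_in_bigo(2)[OF 1 2] show ?thesis by blast
qed

text \<open>
  The terms of order \<open>n\<^sup>2\<close> cancel. The expectation is known up to an error \<open>e\<close> of order \<open>1/n\<close>,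
  so that its square is known up to \<open>O(1)\<close>.
\<close>

lemma variance_asymp:
  "(\<lambda>n. measure_pmf.variance (random_plane_tree n) (\<lambda>t. real (N t))
      - (4 * a + 16 * a\<^sup>2 + 32 * a * b - 8 * c) * real n) \<in> O(\<lambda>n. 1)"
proof -
  define m where "m n = 4 * a * real n - (2 * a + 2 * b)" for n
  define e where "e n = expect n (\<lambda>t. real (N t)) - m n" for n
  define e2 where "e2 n = expect n (\<lambda>t. falling_fact (real (N t)) 2)
      - (16 * a\<^sup>2 * real n ^ 2 + (16 * a * b - 8 * c) * real n)" for n
  have e: "e \<in> O(\<lambda>n. 1 / real n)"
    using expectation_asymp by (simp add: e_def[abs_def] m_def)
  have e2: "e2 \<in> O(\<lambda>n. 1)"
    using second_factorial_moment_asymp by (simp add: e2_def[abs_def])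
  have "(\<lambda>n. 1 / real n) \<in> O(\<lambda>n. 1)" by real_asymp
  with e have e': "e \<in> O(\<lambda>n. 1)" by (rule landau_o.big_trans)
  have "(\<lambda>n. 2 * m n) \<in> O(\<lambda>n. real n)"
    unfolding m_def by real_asymp
  from landau_o.big.mult[OF this e] have "(\<lambda>n. 2 * m n * e n) \<in> O(\<lambda>n. real n * (1 / real n))" .
  also have "(\<lambda>n. real n * (1 / real n)) \<in> O(\<lambda>n. 1)" by real_asymp
  finally have me: "(\<lambda>n. 2 * m n * e n) \<in> O(\<lambda>n. 1)" .
  have ee: "(\<lambda>n. e n * e n) \<in> O(\<lambda>n. 1)"
    using landau_o.big.mult[OF e' e'] by simp
  define K where "K = (2 * a + 2 * b) + (2 * a + 2 * b)\<^sup>2"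
  have var: "measure_pmf.variance (random_plane_tree n) (\<lambda>t. real (N t)) - (4 * a + 16 * a\<^sup>2 + 32 * a * b - 8 * c) * real n
      = e2 n + e n - 2 * m n * e n - e n * e n - K" if n: "n \<ge> 1" for n
  proof -
    let ?E = "expect n"
    have int: "integrable (measure_pmf (random_plane_tree n)) f" for f :: "plane_tree \<Rightarrow> real"
      by (rule integrable_random_plane_tree[OF n])
    have "measure_pmf.variance (random_plane_tree n) (\<lambda>t. real (N t))
        = ?E (\<lambda>t. (real (N t))\<^sup>2) - (?E (\<lambda>t. real (N t)))\<^sup>2"
      by (rule measure_pmf.variance_eq) (rule int)+
    moreover have "?E (\<lambda>t. (real (N t))\<^sup>2) = ?E (\<lambda>t. falling_fact (real (N t)) 2 + real (N t))"
      by (simp add: falling_fact_def numeral_2_eq_2 power2_eq_square algebra_simps)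
    moreover have "\<dots> = ?E (\<lambda>t. falling_fact (real (N t)) 2) + ?E (\<lambda>t. real (N t))"
      by (rule Bochner_Integration.integral_add) (rule int)+
    moreover have "?E (\<lambda>t. falling_fact (real (N t)) 2) = e2 n + (16 * a\<^sup>2 * real n ^ 2 + (16 * a * b - 8 * c) * real n)"
      by (simp add: e2_def)
    moreover have "?E (\<lambda>t. real (N t)) = m n + e n" by (simp add: e_def)
    ultimately have "measure_pmf.variance (random_plane_tree n) (\<lambda>t. real (N t))
        = e2 n + (16 * a\<^sup>2 * real n ^ 2 + (16 * a * b - 8 * c) * real n) + (m n + e n) - (m n + e n)\<^sup>2"
      by metis
    then show ?thesis
      unfolding K_def by (simp only:) (simp add: m_def power2_eq_square algebra_simps)
  qed
  have "(\<lambda>n. e2 n + e n - 2 * m n * e n - e n * e n - K) \<in> O(\<lambda>n. 1)"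
    by (intro sum_in_bigo e2 e' me ee) simp
  also have "?this \<longleftrightarrow> ?thesis"
    by (intro landau_o.big.in_cong eventually_mono[OF eventually_ge_at_top[of 1]]) (simp add: var)
  finally show ?thesis .
qed

end

theorem theorem7:
  fixes r :: nat
  shows
    "((\<lambda>n. measure_pmf.expectation (random_plane_tree n) (\<lambda>t. real (X_square r t))
        - (1 / (real r + 2)^2 * real n + (real r + 3) * (real r + 1) / (6 * (real r + 2)^2)))
      \<in> O(\<lambda>n. 1 / real n)) \<and>
     ((\<lambda>n. measure_pmf.expectation (random_plane_tree n) (\<lambda>t. real (X_bullet r t))
        - (2 * (real r + 1) / (real r + 2)^2 * real n
           - ((real r)^2 + 3 * real r + 3) * (real r + 1) / (3 * (real r + 2)^2)))
      \<in> O(\<lambda>n. 1 / real n)) \<and>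
     ((\<lambda>n. measure_pmf.variance (random_plane_tree n) (\<lambda>t. real (X_square r t))
        - (real r + 3) * (real r + 1) / (3 * (real r + 2)^4) * real n)
      \<in> O(\<lambda>n. 1)) \<and>
     ((\<lambda>n. measure_pmf.variance (random_plane_tree n) (\<lambda>t. real (X_bullet r t))
        - 2 * ((real r)^3 + 4 * (real r)^2 + 6 * real r + 6) * (real r + 1)
            / (3 * (real r + 2)^4) * real n)
      \<in> O(\<lambda>n. 1)) \<and>
     (\<forall>d::nat. d \<ge> 2 \<longrightarrow>
      (\<lambda>n. measure_pmf.expectation (random_plane_tree n) (\<lambda>t. falling_fact (real (X_square r t)) d)
          - 1 / (real r + 2)^(2 * d) * (real n)^d)
        \<in> O(\<lambda>n. (real n)^(d - 1))) \<and>
     (\<forall>d::nat. d \<ge> 2 \<longrightarrow>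
      (\<lambda>n. measure_pmf.expectation (random_plane_tree n) (\<lambda>t. falling_fact (real (X_bullet r t)) d)
          - 2^d * (real r + 1)^d / (real r + 2)^(2 * d) * (real n)^d)
        \<in> O(\<lambda>n. (real n)^(d - 1)))"
proof -
  define x where "x = real r"
  define q where "q = x + 2"
  have q: "q > 0" "x = q - 2" by (auto simp: q_def x_def)
  define \<alpha> \<beta> where "\<alpha> = (x + 1) / (2 * (x + 2))" and "\<beta> = - ((x + 1) * (x + 3) / (6 * (x + 2)))"
  let ?z = "collapsed_gf r :: real fps"
  have z: "expands ?z \<alpha> \<beta>"
    unfolding \<alpha>_def \<beta>_def x_def by (rule collapsed_gf_expands)
  have z2: "expands (?z\<^sup>2) (\<alpha>\<^sup>2) (2 * \<alpha> * \<beta>)"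
    using expands_power[OF z, of 2] by simp

  \<comment> \<open>The expansions of \<open>X - z + z\<^sup>2\<close> and \<open>z - 2 z\<^sup>2\<close> computed from that of \<open>z\<close>; \<open>1 - 2 \<alpha> = 1 / q\<close> simplifies them.\<close>
  define a b where "a = 1 / (4 * q\<^sup>2)" and "b = - (q\<^sup>2 + 2) / (12 * q\<^sup>2)"
  define a' b' where "a' = (x + 1) / (2 * q\<^sup>2)" and "b' = x * (x + 1) * (x + 3) / (6 * q\<^sup>2)"

  have neg: "expands (- f) (- u) (- v)" if "expands f u v" for f u v
    using expands_mult[OF expands_const[of "-1"] that] by (simp flip: fps_const_neg)
  have square: "expands (fps_X - ?z + ?z\<^sup>2) a b"
  proof -
    have "1/4 + (- \<alpha>) + \<alpha>\<^sup>2 = a" "- 1/4 + (- \<beta>) + 2 * \<alpha> * \<beta> = b"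
      using q(1) unfolding a_def b_def \<alpha>_def \<beta>_def q_def[symmetric]
      by (simp_all add: divide_simps q(2)) (simp_all add: algebra_simps power2_eq_square)
    then show ?thesis
      using expands_add[OF expands_add[OF expands_X neg[OF z]] z2] by simp
  qed
  have bullet: "expands (?z - 2 * ?z\<^sup>2) a' b'"
  proof -
    have "\<alpha> + (- (2 * \<alpha>\<^sup>2)) = a'" "\<beta> + (- (2 * (2 * \<alpha> * \<beta>))) = b'"
      using q(1) unfolding a'_def b'_def \<alpha>_def \<beta>_def q_def[symmetric]
      by (simp_all add: divide_simps q(2)) (simp_all add: algebra_simps power2_eq_square)
    then show ?thesis
      using expands_add[OF z neg[OF expands_mult[OF expands_const[of 2] z2]]] 
      by (simp add: numeral_fps_const)
  qed
  have eq_sq: "moment_gf (X_square r) - (moment_gf (X_square r))\<^sup>2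
           = fps_const fps_X + fps_X * (fps_const (fps_X - ?z + ?z\<^sup>2) - fps_X * fps_const 0)"
    using moment_gf_X_square[of r] by simp
  note sq = eq_sq square expands_const[of 0, simplified]
  note bu = moment_gf_X_bullet[of r] bullet z2

  have c1: "4 * a = 1 / q\<^sup>2" and c2: "- (2 * a + 2 * b) = (x + 3) * (x + 1) / (6 * q\<^sup>2)"
    and c3: "4 * a' = 2 * (x + 1) / q\<^sup>2"
    and c4: "2 * a' + 2 * b' = (x\<^sup>2 + 3 * x + 3) * (x + 1) / (3 * q\<^sup>2)"
    and c5: "4 * a + 16 * a\<^sup>2 + 32 * a * b - 8 * 0 = (x + 3) * (x + 1) / (3 * q ^ 4)"
    and c6: "4 * a' + 16 * a'\<^sup>2 + 32 * a' * b' - 8 * \<alpha>\<^sup>2 = 2 * (x ^ 3 + 4 * x\<^sup>2 + 6 * x + 6) * (x + 1) / (3 * q ^ 4)"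
    using q(1) unfolding a_def b_def a'_def b'_def \<alpha>_def q_def[symmetric]
    by (simp_all add: divide_simps q(2)) (simp_all add: algebra_simps power2_eq_square eval_nat_numeral)
  show ?thesis
    unfolding x_def[symmetric] q_def[symmetric]
  proof (intro conjI allI impI)
    show "(\<lambda>n. expect n (\<lambda>t. real (X_square r t)) - (1 / q\<^sup>2 * real n + (x + 3) * (x + 1) / (6 * q\<^sup>2))) \<in> O(\<lambda>n. 1 / real n)"
    proof -
      have "4 * a * real n - (2 * a + 2 * b) = 1 / q\<^sup>2 * real n + (x + 3) * (x + 1) / (6 * q\<^sup>2)" for n
        by (simp add: c1 flip: c2)
      then show ?thesis using expectation_asymp[OF sq] by (simp only:)
    qed
    show "(\<lambda>n. expect n (\<lambda>t. real (X_bullet r t)) - (2 * (x + 1) / q\<^sup>2 * real n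
           - (x\<^sup>2 + 3 * x + 3) * (x + 1) / (3 * q\<^sup>2))) \<in> O(\<lambda>n. 1 / real n)"
      using expectation_asymp[OF bu] unfolding c3 c4 .
    show "(\<lambda>n. measure_pmf.variance (random_plane_tree n) (\<lambda>t. real (X_square r t))
        - (x + 3) * (x + 1) / (3 * q ^ 4) * real n) \<in> O(\<lambda>n. 1)"
      using variance_asymp[OF sq] unfolding c5 .
    show "(\<lambda>n. measure_pmf.variance (random_plane_tree n) (\<lambda>t. real (X_bullet r t))
        - 2 * (x ^ 3 + 4 * x\<^sup>2 + 6 * x + 6) * (x + 1) / (3 * q ^ 4) * real n) \<in> O(\<lambda>n. 1)"
      using variance_asymp[OF bu] unfolding c6 .
    fix d :: nat assume d: "d \<ge> 2"
    then have d': "d \<ge> 1" by simp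
    have p1: "(1 / q\<^sup>2) ^ d = 1 / q ^ (2 * d)" and p2: "(2 * (x + 1) / q\<^sup>2) ^ d = 2 ^ d * (x + 1) ^ d / q ^ (2 * d)"
      by (simp_all only: power_divide power_mult_distrib power_mult power_one)
    show "(\<lambda>n. expect n (\<lambda>t. falling_fact (real (X_square r t)) d) - 1 / q ^ (2 * d) * real n ^ d) \<in> O(\<lambda>n. real n ^ (d - 1))"
      using factorial_moment_asymp[OF sq d'] unfolding c1 p1 .
    show "(\<lambda>n. expect n (\<lambda>t. falling_fact (real (X_bullet r t)) d) - 2 ^ d * (x + 1) ^ d / q ^ (2 * d) * real n ^ d)
         \<in> O(\<lambda>n. real n ^ (d - 1))"
      using factorial_moment_asymp[OF bu d'] unfolding c3 p2 .
  qed
qed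

end
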